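(* There is a numerical constant $c>0$ such that for all integers $n,d$, all $\delta\in[0,\frac12]$ with $2\le d\le\delta n$ and $n\ge\frac{128}{d}$, and all $t>0$, the local minimax rate satisfies $$\mathsf{M}(n,d,\delta,t)\ \ge\ \frac{c}{\sqrt{\log(n)}}\cdot\begin{cases}t, & t\le\left(\frac{\delta d}{n}\right)^{1/4},\\[2pt] \frac1t\sqrt{\frac{\delta d}{n}}, & \left(\frac{\delta d}{n}\right)^{1/4}\le t\le\sqrt\delta,\\[2pt] \sqrt{\frac dn}, & t\ge\sqrt\delta.\end{cases}$$
   Context: Model: $S_0,S_1,\dots,S_n\in\{-1,1\}$ is a Markov chain with $\mathbb{P}[S_0=1]=\frac12$ and, for $i\ge1$, $S_i=S_{i-1}$ with probability $1-\delta$ and $S_i=-S_{i-1}$ with probability $\delta$. The samples are $X_i=S_i\theta_*+Z_i\in\mathbb{R}^d$, $1\le i\le n$, with $Z_i\sim N(0,I_d)$ i.i.d. and independent of $S_0^n$. Let $\mathrm{loss}(\hat\theta,\theta)=\min\{\|\hat\theta-\theta\|,\|\hat\theta+\theta\|\}$ with $\|\cdot\|$ the Euclidean norm. The local minimax rate is $$\mathsf{M}(n,d,\delta,t)=\inf_{\hat\theta}\ \sup_{\theta_*\in\mathbb{R}^d:\,\|\theta_*\|=t}\ \mathbb{E}\big[\mathrm{loss}(\theta_*,\hat\theta(X_1^n))\big],$$ the infimum being over all estimators $\hat\theta$ (measurable functions of $X_1^n=(X_1,\dots,X_n)$, which may depend on $n,d,\delta,t$). $\log$ is the natural logarithm. 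*)

theory Defs
  imports "HOL-Probability.Probability"
begin

text \<open>
  The constant in the lower bound must be uniform in the dimension, so \<open>d\<close> has to be a quantifiable
  natural number: vectors of dimension \<open>d\<close> are extensional functions on the index set \<open>{..<d}\<close>,
  with Euclidean norm \<open>L2_set x {..<d}\<close>.
\<close>

definition vec_space :: "nat \<Rightarrow> (nat \<Rightarrow> real) measure" where
  "vec_space d = (\<Pi>\<^sub>M j\<in>{..<d}. borel)"

definition sample_space :: "nat \<Rightarrow> nat \<Rightarrow> (nat \<Rightarrow> nat \<Rightarrow> real) measure" where
  "sample_space n d = (\<Pi>\<^sub>M i\<in>{1..n}. vec_space d)"

text \<open>
  The joint law of the sign chain \<open>S\<^sub>0, \<dots>, S\<^sub>n\<close>; the values of the path at indices
  above \<open>n\<close> are irrelevant and left \<open>undefined\<close>.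
\<close>

primrec sign_chain :: "real \<Rightarrow> nat \<Rightarrow> (nat \<Rightarrow> real) pmf" where
  "sign_chain \<delta> 0 = map_pmf (\<lambda>s. (\<lambda>_. undefined)(0 := s)) (pmf_of_set {-1, 1})"
| "sign_chain \<delta> (Suc i) =
     bind_pmf (sign_chain \<delta> i) (\<lambda>S.
       map_pmf (\<lambda>flip. S(Suc i := if flip then - S i else S i)) (bernoulli_pmf \<delta>))"

definition std_gaussian :: "nat \<Rightarrow> (nat \<Rightarrow> real) measure" where
  "std_gaussian d = (\<Pi>\<^sub>M j\<in>{..<d}. density lborel std_normal_density)"

text \<open>Independence of the chain and the noise is expressed by the product measure.\<close>

definition chain_noise :: "nat \<Rightarrow> nat \<Rightarrow> real \<Rightarrow> ((nat \<Rightarrow> real) \<times> (nat \<Rightarrow> nat \<Rightarrow> real)) measure" where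
  "chain_noise n d \<delta> = measure_pmf (sign_chain \<delta> n) \<Otimes>\<^sub>M (\<Pi>\<^sub>M i\<in>{1..n}. std_gaussian d)"

definition observe ::
  "nat \<Rightarrow> nat \<Rightarrow> (nat \<Rightarrow> real) \<Rightarrow> (nat \<Rightarrow> real) \<times> (nat \<Rightarrow> nat \<Rightarrow> real) \<Rightarrow> nat \<Rightarrow> nat \<Rightarrow> real" where
  "observe n d \<theta> = (\<lambda>(S, Z). \<lambda>i\<in>{1..n}. \<lambda>j\<in>{..<d}. S i * \<theta> j + Z i j)"

definition sample_law :: "nat \<Rightarrow> nat \<Rightarrow> real \<Rightarrow> (nat \<Rightarrow> real) \<Rightarrow> (nat \<Rightarrow> nat \<Rightarrow> real) measure" where
  "sample_law n d \<delta> \<theta> = distr (chain_noise n d \<delta>) (sample_space n d) (observe n d \<theta>)"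

definition sign_loss :: "nat \<Rightarrow> (nat \<Rightarrow> real) \<Rightarrow> (nat \<Rightarrow> real) \<Rightarrow> real" where
  "sign_loss d \<theta>' \<theta> =
     min (L2_set (\<lambda>j. \<theta>' j - \<theta> j) {..<d}) (L2_set (\<lambda>j. \<theta>' j + \<theta> j) {..<d})"

text \<open>
  Risks are taken in the extended nonnegative reals, so that estimators with non-integrable loss
  have risk \<open>\<infinity>\<close> and infimum and supremum are those of a complete lattice.
\<close>

definition minimax_rate :: "nat \<Rightarrow> nat \<Rightarrow> real \<Rightarrow> real \<Rightarrow> ennreal" where
  "minimax_rate n d \<delta> t =
     (INF est \<in> measurable (sample_space n d) (vec_space d).
      SUP \<theta> \<in> {\<theta> \<in> space (vec_space d). L2_set \<theta> {..<d} = t}.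
        \<integral>\<^sup>+ x. ennreal (sign_loss d \<theta> (est x)) \<partial>sample_law n d \<delta> \<theta>)"

text \<open>
  For \<open>0 < d \<le> \<delta> * n\<close> the two thresholds are ordered and neighbouring branches agree at them.
\<close>

definition lower_rate :: "nat \<Rightarrow> nat \<Rightarrow> real \<Rightarrow> real \<Rightarrow> real" where
  "lower_rate n d \<delta> t =
     (if t \<le> (\<delta> * real d / real n) powr (1/4) then t
      else if t \<le> sqrt \<delta> then 1 / t * sqrt (\<delta> * real d / real n)
      else sqrt (real d / real n))"

lemma observe_measurable: "observe n d \<theta> \<in> measurable (chain_noise n d \<delta>) (sample_space n d)"
proof -
  have S: "(\<lambda>\<omega>. fst \<omega> i) \<in> borel_measurable (chain_noise n d \<delta>)" for i
    unfolding chain_noise_def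
    by (rule measurable_compose[OF measurable_fst]) simp
  have Z: "(\<lambda>\<omega>. snd \<omega> i j) \<in> borel_measurable (chain_noise n d \<delta>)"
    if "i \<in> {1..n}" "j \<in> {..<d}" for i j
  proof -
    have "(\<lambda>z. z j) \<in> borel_measurable (std_gaussian d)"
      unfolding std_gaussian_def
      using measurable_component_singleton[OF that(2), of "\<lambda>_. density lborel std_normal_density"]
      by (simp cong: measurable_cong_sets)
    from measurable_compose[OF measurable_component_singleton[OF that(1)] this]
    have "(\<lambda>z. z i j) \<in> borel_measurable (\<Pi>\<^sub>M i\<in>{1..n}. std_gaussian d)" .
    from measurable_compose[OF measurable_snd this] show ?thesis
      unfolding chain_noise_def .
  qed
  have "(\<lambda>\<omega>. \<lambda>i\<in>{1..n}. \<lambda>j\<in>{..<d}. fst \<omega> i * \<theta> j + snd \<omega> i j)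
      \<in> measurable (chain_noise n d \<delta>) (sample_space n d)"
    unfolding sample_space_def vec_space_def
    by (intro measurable_restrict borel_measurable_add borel_measurable_times S Z
        borel_measurable_const)
  then show ?thesis
    by (simp add: observe_def case_prod_unfold)
qed

lemma prob_space_sample_law: "prob_space (sample_law n d \<delta> \<theta>)"
proof -
  interpret G: prob_space "density lborel std_normal_density"
    by (rule prob_space_normal_density) simp
  have "prob_space (std_gaussian d)"
    unfolding std_gaussian_def by (rule prob_space_PiM) (rule G.prob_space_axioms)
  then have "prob_space (\<Pi>\<^sub>M i\<in>{1..n}. std_gaussian d)"
    by (rule prob_space_PiM)
  then interpret N: prob_space "\<Pi>\<^sub>M i\<in>{1..n}. std_gaussian d" .
  interpret P: pair_prob_space "measure_pmf (sign_chain \<delta> n)" "\<Pi>\<^sub>M i\<in>{1..n}. std_gaussian d" ..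
  have "prob_space (chain_noise n d \<delta>)"
    unfolding chain_noise_def by (rule P.prob_space_axioms)
  then show ?thesis
    unfolding sample_law_def by (rule prob_space.prob_space_distr) (rule observe_measurable)
qed

end

theory Submission
  imports Defs
begin

text \<open>
  A step of the chain either keeps its sign, with probability \<open>1 - 2\<delta>\<close>, or draws a fresh uniform
  sign, with probability \<open>2\<delta>\<close>. Given the refresh times the sample splits into independent blocks
  of constant sign, and the likelihood ratio to pure noise is, up to a constant, the product over
  the blocks of \<open>cosh\<close> of the inner product of the parameter with the block sum. For the two parameters
  \<open>u \<plusminus> w\<close> with \<open>u\<close> orthogonal to \<open>w\<close>, a block of length \<open>k\<close> costs at most
  \<open>min (k\<^sup>2 * \<bar>u\<bar>\<^sup>2 * \<bar>w\<bar>\<^sup>2) (2 * k * \<bar>w\<bar>\<^sup>2)\<close> in Hellinger affinity, and the expected sum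
  of the squared block lengths is at most \<open>n / \<delta>\<close>. So these parameters cannot be told apart as long
  as \<open>\<bar>w\<bar>\<^sup>2\<close> is at most a constant times \<open>max (\<delta> / (n * t\<^sup>2)) (1 / n)\<close>, and Assouad's lemma on a
  cube whose vertices have norm \<open>t\<close> gives the rate. This argument loses no logarithmic factor.
\<close>

subsection \<open>Shifts of Gaussian noise\<close>

text \<open>A finite product measure is determined by its values on boxes, and on a box both sides
  factor into the one-coordinate identities \<open>eq\<close>. It is applied twice, to the
  coordinates of one vector and then to the n samples.\<close>

lemma distr_PiM_density:
  fixes M :: "'i \<Rightarrow> 'a measure" and N :: "'i \<Rightarrow> 'a measure"
  assumes "finite I" and prob: "\<And>i. prob_space (M i)"
    and sets: "\<And>i. sets (N i) = sets (M i)"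
    and f: "\<And>i. f i \<in> measurable (M i) (N i)"
    and g: "\<And>i. g i \<in> borel_measurable (M i)"
    and eq: "\<And>i. distr (M i) (N i) (f i) = density (M i) (g i)"
  shows "distr (PiM I M) (PiM I N) (\<lambda>x. \<lambda>i\<in>I. f i (x i))
       = density (PiM I M) (\<lambda>x. \<Prod>i\<in>I. g i (x i))"
proof -
  note f[measurable] g[measurable]
  interpret M: product_prob_space M
    by (intro product_prob_spaceI prob)
  define D where "D = (\<lambda>i. density (M i) (g i))"
  have "prob_space (D i)" for i
    unfolding D_def eq[symmetric] by (intro prob_space.prob_space_distr prob f)
  then interpret D: product_prob_space D
    by (rule product_prob_spaceI)
  have setsD: "sets (D i) = sets (M i)" for i by (simp add: D_def)
  have "distr (PiM I M) (PiM I N) (\<lambda>x. \<lambda>i\<in>I. f i (x i)) = PiM I D"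
  proof (rule D.PiM_eqI[OF \<open>finite I\<close>])
    show "sets (distr (PiM I M) (PiM I N) (\<lambda>x. \<lambda>i\<in>I. f i (x i))) = sets (PiM I D)"
      by (simp add: sets setsD cong: sets_PiM_cong)
    fix A assume "\<And>i. i \<in> I \<Longrightarrow> A i \<in> sets (D i)"
    then have A: "i \<in> I \<Longrightarrow> A i \<in> sets (N i)" for i by (simp add: setsD sets)
    have meas: "(\<lambda>x. \<lambda>i\<in>I. f i (x i)) \<in> measurable (PiM I M) (PiM I N)"
      by measurable
    have "(\<lambda>x. \<lambda>i\<in>I. f i (x i)) -` Pi\<^sub>E I A \<inter> space (PiM I M) = (\<Pi>\<^sub>E i\<in>I. f i -` A i \<inter> space (M i))"
      by (auto simp: space_PiM PiE_iff extensional_def)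
    then have "emeasure (distr (PiM I M) (PiM I N) (\<lambda>x. \<lambda>i\<in>I. f i (x i))) (Pi\<^sub>E I A)
        = emeasure (PiM I M) (\<Pi>\<^sub>E i\<in>I. f i -` A i \<inter> space (M i))"
      using A \<open>finite I\<close> by (subst emeasure_distr[OF meas]) (auto intro!: sets_PiM_I_finite)
    also have "\<dots> = (\<Prod>i\<in>I. emeasure (M i) (f i -` A i \<inter> space (M i)))"
      using A by (intro M.emeasure_PiM \<open>finite I\<close> measurable_sets[OF f])
    also have "\<dots> = (\<Prod>i\<in>I. emeasure (D i) (A i))"
      using A unfolding D_def eq[symmetric] by (intro prod.cong refl emeasure_distr[symmetric] f)
    finally show "emeasure (distr (PiM I M) (PiM I N) (\<lambda>x. \<lambda>i\<in>I. f i (x i))) (Pi\<^sub>E I A)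
        = (\<Prod>i\<in>I. emeasure (D i) (A i))" .
  qed
  moreover have "density (PiM I M) (\<lambda>x. \<Prod>i\<in>I. g i (x i)) = PiM I D"
  proof (rule D.PiM_eqI[OF \<open>finite I\<close>])
    show "sets (density (PiM I M) (\<lambda>x. \<Prod>i\<in>I. g i (x i))) = sets (PiM I D)"
      by (simp add: setsD cong: sets_PiM_cong)
    fix A assume "\<And>i. i \<in> I \<Longrightarrow> A i \<in> sets (D i)"
    then have A: "i \<in> I \<Longrightarrow> A i \<in> sets (M i)" for i by (simp add: setsD)
    have "emeasure (density (PiM I M) (\<lambda>x. \<Prod>i\<in>I. g i (x i))) (Pi\<^sub>E I A)
        = (\<integral>\<^sup>+x. (\<Prod>i\<in>I. g i (x i)) * indicator (Pi\<^sub>E I A) x \<partial>PiM I M)"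
      using A \<open>finite I\<close> by (intro emeasure_density sets_PiM_I_finite) auto
    also have "\<dots> = (\<integral>\<^sup>+x. (\<Prod>i\<in>I. g i (x i) * indicator (A i) (x i)) \<partial>PiM I M)"
    proof (rule nn_integral_cong)
      fix x assume "x \<in> space (PiM I M)"
      then have "indicator (Pi\<^sub>E I A) x = (\<Prod>i\<in>I. indicator (A i) (x i) :: ennreal)"
        using \<open>finite I\<close> by (auto simp: indicator_def space_PiM PiE_iff)
      then show "(\<Prod>i\<in>I. g i (x i)) * indicator (Pi\<^sub>E I A) x
          = (\<Prod>i\<in>I. g i (x i) * indicator (A i) (x i))"
        by (simp add: prod.distrib)
    qed
    also have "\<dots> = (\<Prod>i\<in>I. \<integral>\<^sup>+y. g i y * indicator (A i) y \<partial>M i)"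
      using A by (intro M.product_nn_integral_prod \<open>finite I\<close> borel_measurable_times_ennreal g) auto
    also have "\<dots> = (\<Prod>i\<in>I. emeasure (D i) (A i))"
      using A unfolding D_def by (intro prod.cong refl emeasure_density[symmetric] g)
    finally show "emeasure (density (PiM I M) (\<lambda>x. \<Prod>i\<in>I. g i (x i))) (Pi\<^sub>E I A)
        = (\<Prod>i\<in>I. emeasure (D i) (A i))" .
  qed
  ultimately show ?thesis by simp
qed

text \<open>Completing the square: the ratio of the N(\<mu>, 1) density to the N(0, 1) density at x
  is \<open>exp (\<mu> * x - \<mu>\<^sup>2 / 2)\<close>.\<close>

lemma std_normal_shift:
  "distr (density lborel std_normal_density) borel (\<lambda>z. \<mu> + z)
   = density (density lborel std_normal_density) (\<lambda>x. ennreal (exp (\<mu> * x - \<mu>\<^sup>2 / 2)))"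
proof -
  interpret G: prob_space "density lborel std_normal_density"
    by (rule prob_space_normal_density) simp
  have "distributed (density lborel std_normal_density) lborel (\<lambda>x. x) std_normal_density"
    by (auto simp: distributed_def distr_id2)
  from G.normal_density_affine[OF this, of 1 \<mu>]
  have "distr (density lborel std_normal_density) lborel (\<lambda>z. \<mu> + z)
      = density lborel (normal_density \<mu> 1)"
    by (simp add: distributed_def)
  also have "\<dots> = density (density lborel std_normal_density) (\<lambda>x. ennreal (exp (\<mu> * x - \<mu>\<^sup>2 / 2)))"
  proof (subst density_density_eq)
    have "normal_density \<mu> 1 x = std_normal_density x * exp (\<mu> * x - \<mu>\<^sup>2 / 2)" for x
      by (simp add: normal_density_def mult_exp_exp power2_eq_square field_simps)
    then show "density lborel (normal_density \<mu> 1)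
        = density lborel (\<lambda>x. ennreal (std_normal_density x) * ennreal (exp (\<mu> * x - \<mu>\<^sup>2 / 2)))"
      by (simp add: ennreal_mult)
  qed auto
  finally show ?thesis
    by (simp cong: distr_cong)
qed

lemma prob_space_std_gaussian: "prob_space (std_gaussian d)"
  unfolding std_gaussian_def by (intro prob_space_PiM prob_space_normal_density) simp

lemma sets_std_gaussian: "sets (std_gaussian d) = sets (vec_space d)"
  unfolding std_gaussian_def vec_space_def by (simp cong: sets_PiM_cong)

text \<open>The common reference measure: all likelihoods below are densities with respect to pure
  noise.\<close>

definition noise :: "nat \<Rightarrow> nat \<Rightarrow> (nat \<Rightarrow> nat \<Rightarrow> real) measure" where
  "noise n d = (\<Pi>\<^sub>M i\<in>{1..n}. std_gaussian d)"

lemma prob_space_noise: "prob_space (noise n d)"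
  unfolding noise_def by (intro prob_space_PiM prob_space_std_gaussian)

lemma sets_noise [measurable_cong]: "sets (noise n d) = sets (sample_space n d)"
  unfolding noise_def sample_space_def by (simp add: sets_std_gaussian cong: sets_PiM_cong)

lemma measurable_coordinate_noise:
  "i \<in> {1..n} \<Longrightarrow> j \<in> {..<d} \<Longrightarrow> (\<lambda>x. x i j) \<in> borel_measurable (noise n d)"
  unfolding measurable_cong_sets[OF sets_noise refl] sample_space_def vec_space_def
  by (rule measurable_compose[OF measurable_component_singleton]) auto

definition pairing :: "nat \<Rightarrow> nat \<Rightarrow> (nat \<Rightarrow> nat \<Rightarrow> real) \<Rightarrow> (nat \<Rightarrow> nat \<Rightarrow> real) \<Rightarrow> real" where
  "pairing n d \<mu> x = (\<Sum>i\<in>{1..n}. \<Sum>j\<in>{..<d}. \<mu> i j * x i j)"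

lemma pairing_measurable [measurable]: "pairing n d \<mu> \<in> borel_measurable (noise n d)"
  unfolding pairing_def[abs_def]
  by (intro borel_measurable_sum borel_measurable_times borel_measurable_const measurable_coordinate_noise)

text \<open>Finite-dimensional Cameron-Martin formula. \<open>pairing n d\<close> is the inner
  product of n-by-d arrays, so \<open>pairing n d \<mu> \<mu>\<close> is the squared norm of the
  shift.\<close>

lemma noise_shift:
  "distr (noise n d) (sample_space n d) (\<lambda>Z. \<lambda>i\<in>{1..n}. \<lambda>j\<in>{..<d}. \<mu> i j + Z i j)
   = density (noise n d) (\<lambda>x. ennreal (exp (pairing n d \<mu> x - pairing n d \<mu> \<mu> / 2)))"
proof -
  have 1: "distr (std_gaussian d) (vec_space d) (\<lambda>z. \<lambda>j\<in>{..<d}. \<mu> i j + z j)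
     = density (std_gaussian d) (\<lambda>x. \<Prod>j\<in>{..<d}. ennreal (exp (\<mu> i j * x j - (\<mu> i j)\<^sup>2 / 2)))" for i
    unfolding std_gaussian_def vec_space_def
    by (rule distr_PiM_density[of _ "\<lambda>_. density lborel std_normal_density" "\<lambda>_. borel"
          "\<lambda>j z. \<mu> i j + z" "\<lambda>j x. ennreal (exp (\<mu> i j * x - (\<mu> i j)\<^sup>2 / 2))"])
      (auto intro!: prob_space_normal_density std_normal_shift)
  have m1: "(\<lambda>z. \<lambda>j\<in>{..<d}. \<mu> i j + z j) \<in> measurable (std_gaussian d) (vec_space d)" for i
    unfolding std_gaussian_def vec_space_def by measurable
  have m2: "(\<lambda>x. \<Prod>j\<in>{..<d}. ennreal (exp (\<mu> i j * x j - (\<mu> i j)\<^sup>2 / 2))) \<in> borel_measurable (std_gaussian d)" for i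
    unfolding std_gaussian_def by measurable
  have "distr (noise n d) (sample_space n d) (\<lambda>Z. \<lambda>i\<in>{1..n}. \<lambda>j\<in>{..<d}. \<mu> i j + Z i j)
   = density (noise n d) (\<lambda>x. \<Prod>i\<in>{1..n}. \<Prod>j\<in>{..<d}. ennreal (exp (\<mu> i j * x i j - (\<mu> i j)\<^sup>2 / 2)))"
    unfolding noise_def sample_space_def
    by (rule distr_PiM_density[of _ "\<lambda>_. std_gaussian d" "\<lambda>_. vec_space d"
          "\<lambda>i z. \<lambda>j\<in>{..<d}. \<mu> i j + z j" "\<lambda>i x. \<Prod>j\<in>{..<d}. ennreal (exp (\<mu> i j * x j - (\<mu> i j)\<^sup>2 / 2))"])
      (auto intro!: prob_space_std_gaussian 1 m1 m2 simp: sets_std_gaussian)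
  also have "(\<lambda>x. \<Prod>i\<in>{1..n}. \<Prod>j\<in>{..<d}. ennreal (exp (\<mu> i j * x i j - (\<mu> i j)\<^sup>2 / 2)))
      = (\<lambda>x. ennreal (exp (pairing n d \<mu> x - pairing n d \<mu> \<mu> / 2)))"
    by (simp add: fun_eq_iff prod_ennreal prod_nonneg pairing_def exp_sum sum_subtractf
        sum_divide_distrib power2_eq_square flip: exp_sum)
  finally show ?thesis .
qed

text \<open>The Gaussian moment generating function, read off from the fact that the shifted law in
  \<open>noise_shift\<close> has total mass 1.\<close>

lemma nn_integral_exp_pairing:
  "(\<integral>\<^sup>+x. ennreal (exp (pairing n d \<mu> x)) \<partial>noise n d) = ennreal (exp (pairing n d \<mu> \<mu> / 2))"
proof -
  have meas: "(\<lambda>Z. \<lambda>i\<in>{1..n}. \<lambda>j\<in>{..<d}. \<mu> i j + Z i j) \<in> measurable (noise n d) (sample_space n d)"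
    unfolding sample_space_def vec_space_def
    by (intro measurable_restrict borel_measurable_add borel_measurable_const measurable_coordinate_noise)
  interpret prob_space "density (noise n d) (\<lambda>x. ennreal (exp (pairing n d \<mu> x - pairing n d \<mu> \<mu> / 2)))"
    unfolding noise_shift[symmetric]
    by (intro prob_space.prob_space_distr prob_space_noise meas)
  have "1 = (\<integral>\<^sup>+x. ennreal (exp (pairing n d \<mu> x - pairing n d \<mu> \<mu> / 2)) \<partial>noise n d)"
    using emeasure_space_1 by (simp add: emeasure_density cong: nn_integral_cong)
  also have "\<dots> = (\<integral>\<^sup>+x. ennreal (exp (- pairing n d \<mu> \<mu> / 2)) * ennreal (exp (pairing n d \<mu> x)) \<partial>noise n d)"
    by (simp add: ennreal_mult[symmetric] mult_exp_exp add.commute)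
  also have "\<dots> = ennreal (exp (- pairing n d \<mu> \<mu> / 2)) * (\<integral>\<^sup>+x. ennreal (exp (pairing n d \<mu> x)) \<partial>noise n d)"
    by (intro nn_integral_cmult) simp
  finally have "ennreal (exp (pairing n d \<mu> \<mu> / 2)) * 1
      = ennreal (exp (pairing n d \<mu> \<mu> / 2)) * (ennreal (exp (- pairing n d \<mu> \<mu> / 2)) * (\<integral>\<^sup>+x. ennreal (exp (pairing n d \<mu> x)) \<partial>noise n d))"
    by simp
  then show ?thesis
    by (simp add: mult.assoc[symmetric] ennreal_mult[symmetric] mult_exp_exp)
qed

subsection \<open>The sign chain as a mixture over block partitions\<close>

text \<open>\<open>b i\<close> is the last refresh time not after i, with time 0 counted as a
  refresh; it serves as the label of the block containing i.\<close>

primrec block_law :: "real \<Rightarrow> nat \<Rightarrow> (nat \<Rightarrow> nat) pmf" where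
  "block_law \<delta> 0 = return_pmf (\<lambda>_. 0)"
| "block_law \<delta> (Suc n) = bind_pmf (block_law \<delta> n) (\<lambda>b.
     map_pmf (\<lambda>r. b(Suc n := if r then Suc n else b n)) (bernoulli_pmf (2 * \<delta>)))"

text \<open>One independent sign for every possible label, including labels that start no block;
  such a label later contributes only a factor \<open>cosh 0 = 1\<close>. The default value 1 keeps
  \<open>s r\<close> a sign for all r.\<close>

definition signs :: "nat \<Rightarrow> (nat \<Rightarrow> real) pmf" where
  "signs n = Pi_pmf {..n} 1 (\<lambda>_. pmf_of_set {-1, 1})"

lemma block_law_le:
  assumes "b \<in> set_pmf (block_law \<delta> n)" "i \<le> n"
  shows "b i \<le> i"
  using assms by (induction n arbitrary: b i) (force simp: le_Suc_eq)+

lemma block_law_image: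
  assumes "b \<in> set_pmf (block_law \<delta> n)"
  shows "b ` {1..n} \<subseteq> {..n}"
  using block_law_le[OF assms] by (fastforce dest: le_trans)

lemma signs_values:
  assumes "s \<in> set_pmf (signs n)"
  shows "s r = -1 \<or> s r = 1"
  using assms unfolding signs_def
  by (cases "r \<le> n") (auto simp: set_Pi_pmf PiE_dflt_def)

lemma signs_Suc:
  "signs (Suc n) = bind_pmf (signs n) (\<lambda>s. map_pmf (\<lambda>x. s(Suc n := x)) (pmf_of_set {-1, 1}))"
proof -
  have "signs (Suc n) = bind_pmf (pmf_of_set {-1, 1}) (\<lambda>x. bind_pmf (signs n) (\<lambda>s. return_pmf (s(Suc n := x))))"
    unfolding signs_def atMost_Suc by (subst Pi_pmf_insert') auto
  then show ?thesis
    by (subst (asm) bind_commute_pmf) (simp add: map_pmf_def)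
qed

text \<open>A fresh uniform sign differs from the old one with probability 1/2, so refreshing with
  probability \<open>2 * \<delta>\<close> flips with probability \<delta>. The bound \<delta> \<le>
  1/2 makes \<open>2 * \<delta>\<close> a probability.\<close>

lemma flip_eq_refresh:
  fixes x :: real
  assumes "0 \<le> \<delta>" "\<delta> \<le> 1/2" "x = -1 \<or> x = 1"
  shows "map_pmf (\<lambda>flip. if flip then - x else x) (bernoulli_pmf \<delta>)
    = bind_pmf (bernoulli_pmf (2 * \<delta>)) (\<lambda>r. if r then pmf_of_set {-1, 1} else return_pmf x)"
proof (rule pmf_eqI)
  fix y
  have "pmf (map_pmf (\<lambda>flip. if flip then - x else x) (bernoulli_pmf \<delta>)) y
      = (if y = - x then \<delta> else if y = x then 1 - \<delta> else 0)"
    using assms unfolding map_pmf_def by (auto simp: pmf_bind)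
  moreover have "pmf (bind_pmf (bernoulli_pmf (2 * \<delta>)) (\<lambda>r. if r then pmf_of_set {-1, 1} else return_pmf x)) y
      = (if y = - x then \<delta> else if y = x then 1 - \<delta> else 0)"
    using assms by (auto simp: pmf_bind)
  ultimately show "pmf (map_pmf (\<lambda>flip. if flip then - x else x) (bernoulli_pmf \<delta>)) y
      = pmf (bind_pmf (bernoulli_pmf (2 * \<delta>)) (\<lambda>r. if r then pmf_of_set {-1, 1} else return_pmf x)) y"
    by simp
qed

text \<open>The value \<open>undefined\<close> above n matches \<open>sign_chain\<close>, so that
  the two laws agree as laws of functions.\<close>

definition block_path :: "nat \<Rightarrow> (nat \<Rightarrow> nat) \<Rightarrow> (nat \<Rightarrow> real) \<Rightarrow> nat \<Rightarrow> real" where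
  "block_path n b s i = (if i \<le> n then s (b i) else undefined)"

text \<open>Labels of old indices never exceed n, so a sign stored at label \<open>Suc n\<close>
  cannot alter the earlier path.\<close>

lemma block_path_Suc:
  assumes "\<And>i. i \<le> n \<Longrightarrow> b i \<le> i"
  shows "block_path (Suc n) (b(Suc n := if r then Suc n else b n)) (s(Suc n := x))
    = (block_path n b s)(Suc n := if r then x else s (b n))"
proof
  fix i
  have "b i \<noteq> Suc n" if "i \<le> n" for i using assms[OF that] that by simp
  then show "block_path (Suc n) (b(Suc n := if r then Suc n else b n)) (s(Suc n := x)) i
    = ((block_path n b s)(Suc n := if r then x else s (b n))) i"
    by (auto simp: block_path_def le_Suc_eq)
qed

lemma sign_chain_eq_blocks:
  assumes \<delta>: "0 \<le> \<delta>" "\<delta> \<le> 1/2"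
  shows "sign_chain \<delta> n = bind_pmf (block_law \<delta> n) (\<lambda>b. map_pmf (block_path n b) (signs n))"
proof (induction n)
  case 0
  have "block_path 0 (\<lambda>_. 0) (\<lambda>b. if b = 0 then a else 1) = (\<lambda>_. undefined)(0 := a)" for a
    by (auto simp: block_path_def)
  then show ?case
    by (simp add: signs_def Pi_pmf_singleton bind_return_pmf pmf.map_comp o_def)
next
  case (Suc n)
  let ?u = "pmf_of_set {-1, 1 :: real}" and ?R = "bernoulli_pmf (2 * \<delta>)"
  have "bind_pmf (signs n) (\<lambda>s. map_pmf (\<lambda>flip. (block_path n b s)(Suc n := if flip then - block_path n b s n else block_path n b s n)) (bernoulli_pmf \<delta>))
      = bind_pmf ?R (\<lambda>r. map_pmf (block_path (Suc n) (b(Suc n := if r then Suc n else b n))) (signs (Suc n)))"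
    if b: "b \<in> set_pmf (block_law \<delta> n)" for b
  proof -
    note le = block_law_le[OF b]
    \<comment> \<open>A fresh sign x is drawn in both cases and ignored if there is no refresh. The
      draw then does not depend on r and can be absorbed into \<open>signs (Suc n)\<close>.\<close>
    have "map_pmf (\<lambda>flip. (block_path n b s)(Suc n := if flip then - block_path n b s n else block_path n b s n)) (bernoulli_pmf \<delta>)
      = bind_pmf ?R (\<lambda>r. map_pmf (\<lambda>x. (block_path n b s)(Suc n := if r then x else s (b n))) ?u)"
      if "s \<in> set_pmf (signs n)" for s
    proof -
      have "map_pmf (\<lambda>flip. (block_path n b s)(Suc n := if flip then - block_path n b s n else block_path n b s n)) (bernoulli_pmf \<delta>)
        = map_pmf (\<lambda>y. (block_path n b s)(Suc n := y)) (map_pmf (\<lambda>flip. if flip then - s (b n) else s (b n)) (bernoulli_pmf \<delta>))"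
        by (simp only: pmf.map_comp o_def block_path_def order.refl if_True)
      also have "\<dots> = bind_pmf ?R (\<lambda>r. map_pmf (\<lambda>x. (block_path n b s)(Suc n := if r then x else s (b n))) ?u)"
        unfolding flip_eq_refresh[OF \<delta> signs_values[OF that]] map_bind_pmf
        by (intro bind_pmf_cong refl) (auto simp: map_pmf_def bind_return_pmf)
      finally show ?thesis .
    qed
    then have "bind_pmf (signs n) (\<lambda>s. map_pmf (\<lambda>flip. (block_path n b s)(Suc n := if flip then - block_path n b s n else block_path n b s n)) (bernoulli_pmf \<delta>))
      = bind_pmf (signs n) (\<lambda>s. bind_pmf ?R (\<lambda>r. map_pmf (\<lambda>x. (block_path n b s)(Suc n := if r then x else s (b n))) ?u))"
      by (intro bind_pmf_cong refl)
    also have "\<dots> = bind_pmf ?R (\<lambda>r. bind_pmf (signs n) (\<lambda>s. map_pmf (\<lambda>x. block_path (Suc n) (b(Suc n := if r then Suc n else b n)) (s(Suc n := x))) ?u))"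
      by (subst bind_commute_pmf) (simp add: block_path_Suc le)
    also have "\<dots> = bind_pmf ?R (\<lambda>r. map_pmf (block_path (Suc n) (b(Suc n := if r then Suc n else b n))) (signs (Suc n)))"
      by (simp add: signs_Suc map_bind_pmf pmf.map_comp o_def)
    finally show ?thesis .
  qed
  then have "bind_pmf (block_law \<delta> n) (\<lambda>b. bind_pmf (signs n) (\<lambda>s. map_pmf (\<lambda>flip. (block_path n b s)(Suc n := if flip then - block_path n b s n else block_path n b s n)) (bernoulli_pmf \<delta>)))
      = bind_pmf (block_law \<delta> n) (\<lambda>b. bind_pmf ?R (\<lambda>r. map_pmf (block_path (Suc n) (b(Suc n := if r then Suc n else b n))) (signs (Suc n))))"
    by (intro bind_pmf_cong refl)
  then show ?case
    by (simp add: Suc.IH bind_assoc_pmf bind_map_pmf)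
qed

section \<open>The expected sum of squared block lengths\<close>

definition block_pairs :: "nat \<Rightarrow> (nat \<Rightarrow> nat) \<Rightarrow> real" where
  "block_pairs n b = (\<Sum>i\<in>{1..n}. \<Sum>k\<in>{1..n}. of_bool (b i = b k))"

definition last_block_size :: "nat \<Rightarrow> (nat \<Rightarrow> nat) \<Rightarrow> real" where
  "last_block_size n b = (\<Sum>i\<in>{1..n}. of_bool (b i = b n))"

lemma finite_block_law [simp]: "finite (set_pmf (block_law \<delta> n))"
  by (induction n) auto

text \<open>Ordered pairs in a common block are counted because they obey a one-step recursion: a
  new index that joins the last block, of size L, adds \<open>2 * L + 1\<close> pairs, and a refresh
  adds 1. The mean of L stays below \<open>1 / (2 * \<delta>)\<close>, so each step adds at most
  \<open>1 / \<delta>\<close> on average.\<close>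

lemma expectation_block_pairs:
  assumes \<delta>: "0 < \<delta>" "\<delta> \<le> 1/2"
  shows "measure_pmf.expectation (block_law \<delta> n) (block_pairs n) \<le> real n / \<delta>"
proof -
  \<comment> \<open>the weight for which the last-block terms cancel: the mean of \<open>W\<close> grows by exactly
    \<open>(1 - \<delta>) / \<delta>\<close> per step\<close>
  define W where "W n b = block_pairs n b + (1 - 2 * \<delta>) / \<delta> * last_block_size n b" for n b
  have "measure_pmf.expectation (block_law \<delta> n) (W n) \<le> real n / \<delta>"
  proof (induction n)
    case 0
    then show ?case by (simp add: W_def block_pairs_def last_block_size_def)
  next
    case (Suc n)
    have step: "measure_pmf.expectation (bernoulli_pmf (2 * \<delta>)) (\<lambda>r. W (Suc n) (b(Suc n := if r then Suc n else b n)))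
        = W n b + (1 - \<delta>) / \<delta>" if b: "b \<in> set_pmf (block_law \<delta> n)" for b
    proof -
      have ne: "b i \<noteq> Suc n" if "i \<in> {1..n}" for i using block_law_le[OF b, of i] that by simp
      have sum_atMost: "(\<Sum>i\<in>{1..Suc n}. f i) = (\<Sum>i\<in>{1..n}. f i) + f (Suc n)" for f :: "nat \<Rightarrow> real"
        by simp
      let ?c = "\<lambda>v. b(Suc n := v)"
      have same: "?c v i = b i" if "i \<in> {1..n}" for v i using that by simp
      \<comment> \<open>The new index forms two ordered pairs with each old member of its block and
        one with itself.\<close>
      have P: "block_pairs (Suc n) (?c v) = block_pairs n b + 2 * (\<Sum>i\<in>{1..n}. of_bool (b i = v)) + 1" for v
      proof -
        have "(\<Sum>i\<in>{1..n}. of_bool (v = b i)) = (\<Sum>i\<in>{1..n}. of_bool (b i = v) :: real)"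
          by (simp only: eq_commute)
        then show ?thesis
          unfolding block_pairs_def sum_atMost sum.distrib
          by (simp add: same del: sum_of_bool_eq cong: sum.cong_simp)
      qed
      have L: "last_block_size (Suc n) (?c v) = (\<Sum>i\<in>{1..n}. of_bool (b i = v)) + 1" for v
        unfolding last_block_size_def sum_atMost by (simp add: same del: sum_of_bool_eq cong: sum.cong_simp)
      have "(\<Sum>i\<in>{1..n}. of_bool (b i = Suc n)) = (0::real)" using ne by (intro sum.neutral) auto
      then show ?thesis
        using \<delta> by (simp add: W_def P L last_block_size_def[of n b] field_simps power2_eq_square)
    qed
    have "measure_pmf.expectation (block_law \<delta> (Suc n)) (W (Suc n))
        = measure_pmf.expectation (block_law \<delta> n) (\<lambda>b. measure_pmf.expectation (bernoulli_pmf (2 * \<delta>)) (\<lambda>r. W (Suc n) (b(Suc n := if r then Suc n else b n))))"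
      by (simp add: pmf_expectation_bind[of "set_pmf (block_law \<delta> n)"] integral_measure_pmf[of "set_pmf (block_law \<delta> n)"])
    also have "\<dots> = measure_pmf.expectation (block_law \<delta> n) (\<lambda>b. W n b + (1 - \<delta>) / \<delta>)"
      by (intro integral_cong_AE) (auto simp: AE_measure_pmf_iff step)
    also have "\<dots> = measure_pmf.expectation (block_law \<delta> n) (W n) + (1 - \<delta>) / \<delta>"
      by (subst Bochner_Integration.integral_add) (auto intro: integrable_measure_pmf_finite)
    also have "\<dots> \<le> real (Suc n) / \<delta>"
      using Suc.IH \<delta> by (simp add: add_divide_distrib diff_divide_distrib)
    finally show ?case .
  qed
  moreover have "measure_pmf.expectation (block_law \<delta> n) (block_pairs n) \<le> measure_pmf.expectation (block_law \<delta> n) (W n)"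
    using \<delta> by (intro integral_mono integrable_measure_pmf_finite) (auto simp: W_def last_block_size_def intro!: sum_nonneg)
  ultimately show ?thesis by simp
qed

subsection \<open>Likelihoods given the blocks\<close>

lemma nn_integral_pmf_swap:
  assumes "finite (set_pmf p)" "\<And>s. f s \<in> borel_measurable M"
  shows "(\<integral>\<^sup>+s. \<integral>\<^sup>+x. f s x \<partial>M \<partial>measure_pmf p) = (\<integral>\<^sup>+x. \<integral>\<^sup>+s. f s x \<partial>measure_pmf p \<partial>M)"
  using assms by (simp add: nn_integral_measure_pmf_finite nn_integral_sum nn_integral_multc)

lemma finite_signs [simp]: "finite (set_pmf (signs n))"
  unfolding signs_def by (subst set_Pi_pmf) auto

definition block_dot :: "nat \<Rightarrow> nat \<Rightarrow> (nat \<Rightarrow> nat) \<Rightarrow> (nat \<Rightarrow> real) \<Rightarrow> nat \<Rightarrow> (nat \<Rightarrow> nat \<Rightarrow> real) \<Rightarrow> real" where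
  "block_dot n d b v r x = (\<Sum>i\<in>{i\<in>{1..n}. b i = r}. \<Sum>j\<in>{..<d}. v j * x i j)"

definition block_size :: "nat \<Rightarrow> (nat \<Rightarrow> nat) \<Rightarrow> nat \<Rightarrow> real" where
  "block_size n b r = real (card {i\<in>{1..n}. b i = r})"

definition norm_sq :: "nat \<Rightarrow> (nat \<Rightarrow> real) \<Rightarrow> real" where
  "norm_sq d v = (\<Sum>j\<in>{..<d}. (v j)\<^sup>2)"

lemma block_dot_measurable [measurable]: "block_dot n d b v r \<in> borel_measurable (noise n d)"
  unfolding block_dot_def[abs_def]
  by (intro borel_measurable_sum borel_measurable_times borel_measurable_const measurable_coordinate_noise) auto

text \<open>The signs are independent, and the mean of \<open>exp (s * c)\<close> over a uniform
  sign s is \<open>cosh c\<close>.\<close>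

lemma nn_integral_signs_exp:
  "(\<integral>\<^sup>+s. ennreal (exp (\<Sum>r\<le>n. s r * c r)) \<partial>measure_pmf (signs n)) = ennreal (\<Prod>r\<le>n. cosh (c r))"
proof -
  have "(\<integral>\<^sup>+s. ennreal (exp (\<Sum>r\<le>n. s r * c r)) \<partial>measure_pmf (signs n))
      = (\<integral>\<^sup>+s. (\<Prod>r\<le>n. ennreal (exp (s r * c r))) \<partial>measure_pmf (signs n))"
    by (simp add: exp_sum prod_ennreal)
  also have "\<dots> = (\<Prod>r\<le>n. \<integral>\<^sup>+y. ennreal (exp (y * c r)) \<partial>measure_pmf (pmf_of_set {-1, 1}))"
    unfolding signs_def by (rule nn_integral_prod_Pi_pmf) simp
  also have "\<dots> = (\<Prod>r\<le>n. ennreal (cosh (c r)))"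
  proof (intro prod.cong refl)
    fix r
    have "(\<integral>\<^sup>+y. ennreal (exp (y * c r)) \<partial>measure_pmf (pmf_of_set {-1, 1}))
        = (ennreal (exp (- c r)) + ennreal (exp (c r))) / 2"
      by (subst nn_integral_pmf_of_set) (auto simp: ennreal_plus[symmetric] simp del: ennreal_plus)
    also have "\<dots> = ennreal (cosh (c r))"
      by (simp add: ennreal_plus[symmetric] divide_ennreal[symmetric] cosh_def field_simps del: ennreal_plus
          flip: ennreal_numeral)
    finally show "(\<integral>\<^sup>+y. ennreal (exp (y * c r)) \<partial>measure_pmf (pmf_of_set {-1, 1})) = ennreal (cosh (c r))" .
  qed
  also have "\<dots> = ennreal (\<Prod>r\<le>n. cosh (c r))"
    by (simp add: prod_ennreal cosh_real_nonneg)
  finally show ?thesis .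
qed

lemma sum_blocks:
  fixes n :: nat and b :: "nat \<Rightarrow> nat"
  assumes "b ` {1..n} \<subseteq> {..n}"
  shows "(\<Sum>i\<in>{1..n}. h i) = (\<Sum>r\<le>n. \<Sum>i\<in>{i\<in>{1..n}. b i = r}. h i)"
  using assms using assms by (intro sum.group[of "{1..n}" "{..n}" b h, symmetric] finite_atLeastAtMost finite_atMost) auto

lemma pairing_block:
  assumes "b ` {1..n} \<subseteq> {..n}"
  shows "pairing n d (\<lambda>i j. s (b i) * v j) x = (\<Sum>r\<le>n. s r * block_dot n d b v r x)"
proof -
  have "pairing n d (\<lambda>i j. s (b i) * v j) x
      = (\<Sum>r\<le>n. \<Sum>i\<in>{i\<in>{1..n}. b i = r}. \<Sum>j\<in>{..<d}. s (b i) * v j * x i j)"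
    unfolding pairing_def by (rule sum_blocks[OF assms])
  then show ?thesis
    by (simp add: block_dot_def sum_distrib_left mult.assoc cong: sum.cong_simp)
qed

lemma pairing_add: "pairing n d (\<lambda>i j. \<mu> i j + \<nu> i j) x = pairing n d \<mu> x + pairing n d \<nu> x"
  by (simp add: pairing_def sum.distrib distrib_right)

lemma pairing_cong:
  "(\<And>i j. i \<in> {1..n} \<Longrightarrow> \<mu> i j = \<nu> i j) \<Longrightarrow> pairing n d \<mu> x = pairing n d \<nu> x"
  unfolding pairing_def by (intro sum.cong refl) auto

text \<open>Each \<open>cosh\<close> is written as an average over a sign, with independent families
  s for u and s' for w. After exchanging the integrals only a Gaussian exponential moment remains.
  Orthogonality removes the cross term, so this moment does not depend on the signs. The weights
  \<alpha> and \<beta> allow the factor of a single block to be switched off later.\<close>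

lemma nn_integral_cosh_prod:
  assumes b: "b ` {1..n} \<subseteq> {..n}"
    and orth: "(\<Sum>j\<in>{..<d}. u j * w j) = 0"
  shows "(\<integral>\<^sup>+x. ennreal (\<Prod>r\<le>n. cosh (\<alpha> r * block_dot n d b u r x) * cosh (\<beta> r * block_dot n d b w r x)) \<partial>noise n d)
    = ennreal (exp ((\<Sum>r\<le>n. block_size n b r * ((\<alpha> r)\<^sup>2 * norm_sq d u + (\<beta> r)\<^sup>2 * norm_sq d w)) / 2))"
proof -
  define \<mu> where "\<mu> s s' i j = s (b i) * \<alpha> (b i) * u j + s' (b i) * \<beta> (b i) * w j" for s s' :: "nat \<Rightarrow> real" and i j
  let ?E = "(\<Sum>r\<le>n. block_size n b r * ((\<alpha> r)\<^sup>2 * norm_sq d u + (\<beta> r)\<^sup>2 * norm_sq d w)) / 2"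
  have pair: "exp (pairing n d (\<mu> s s') x) = exp (\<Sum>r\<le>n. s r * (\<alpha> r * block_dot n d b u r x))
      * exp (\<Sum>r\<le>n. s' r * (\<beta> r * block_dot n d b w r x))" for s s' x
    unfolding \<mu>_def pairing_add
    using pairing_block[OF b, where s="\<lambda>r. s r * \<alpha> r" and d=d and v=u and x=x]
      pairing_block[OF b, where s="\<lambda>r. s' r * \<beta> r" and d=d and v=w and x=x]
    by (simp add: exp_add mult.assoc)
  have self: "pairing n d (\<mu> s s') (\<mu> s s') / 2 = ?E"
    if "s \<in> set_pmf (signs n)" "s' \<in> set_pmf (signs n)" for s s'
  proof -
    have sq: "(s r)\<^sup>2 = 1" "(s' r)\<^sup>2 = 1" for r
      using signs_values[OF that(1), of r] signs_values[OF that(2), of r] by auto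
    have "(\<Sum>j\<in>{..<d}. \<mu> s s' i j * \<mu> s s' i j)
        = (\<alpha> (b i))\<^sup>2 * norm_sq d u + (\<beta> (b i))\<^sup>2 * norm_sq d w" for i
    proof -
      have "\<mu> s s' i j * \<mu> s s' i j = (s (b i))\<^sup>2 * (\<alpha> (b i))\<^sup>2 * (u j)\<^sup>2 + (s' (b i))\<^sup>2 * (\<beta> (b i))\<^sup>2 * (w j)\<^sup>2
          + 2 * s (b i) * \<alpha> (b i) * s' (b i) * \<beta> (b i) * (u j * w j)" for j
        by (simp add: \<mu>_def power2_eq_square algebra_simps)
      then show ?thesis
        by (simp only: sum.distrib sum_distrib_left[symmetric] orth norm_sq_def sq)
    qed
    then have "pairing n d (\<mu> s s') (\<mu> s s') = (\<Sum>i\<in>{1..n}. (\<alpha> (b i))\<^sup>2 * norm_sq d u + (\<beta> (b i))\<^sup>2 * norm_sq d w)"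
      unfolding pairing_def by simp
    also have "\<dots> = 2 * ?E"
      by (subst sum_blocks[OF b]) (simp add: block_size_def cong: sum.cong_simp)
    finally show ?thesis by simp
  qed
  have "(\<integral>\<^sup>+x. ennreal (\<Prod>r\<le>n. cosh (\<alpha> r * block_dot n d b u r x) * cosh (\<beta> r * block_dot n d b w r x)) \<partial>noise n d)
      = (\<integral>\<^sup>+x. (\<integral>\<^sup>+s. \<integral>\<^sup>+s'. ennreal (exp (pairing n d (\<mu> s s') x)) \<partial>measure_pmf (signs n) \<partial>measure_pmf (signs n)) \<partial>noise n d)"
    by (simp add: pair ennreal_mult nn_integral_cmult nn_integral_multc nn_integral_signs_exp prod.distrib prod_nonneg)
  also have "\<dots> = (\<integral>\<^sup>+s. \<integral>\<^sup>+s'. (\<integral>\<^sup>+x. ennreal (exp (pairing n d (\<mu> s s') x)) \<partial>noise n d) \<partial>measure_pmf (signs n) \<partial>measure_pmf (signs n))"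
  proof -
    have "(\<integral>\<^sup>+s'. \<integral>\<^sup>+x. ennreal (exp (pairing n d (\<mu> s s') x)) \<partial>noise n d \<partial>measure_pmf (signs n))
        = (\<integral>\<^sup>+x. \<integral>\<^sup>+s'. ennreal (exp (pairing n d (\<mu> s s') x)) \<partial>measure_pmf (signs n) \<partial>noise n d)" for s
      by (rule nn_integral_pmf_swap) auto
    moreover have "(\<lambda>x. \<integral>\<^sup>+s'. ennreal (exp (pairing n d (\<mu> s s') x)) \<partial>measure_pmf (signs n)) \<in> borel_measurable (noise n d)" for s
      by (simp add: nn_integral_measure_pmf_finite)
    ultimately show ?thesis
      by (simp only: nn_integral_pmf_swap[OF finite_signs])
  qed
  also have "\<dots> = (\<integral>\<^sup>+s. \<integral>\<^sup>+s'. ennreal (exp ?E) \<partial>measure_pmf (signs n) \<partial>measure_pmf (signs n))"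
    unfolding nn_integral_exp_pairing
    by (intro nn_integral_cong_AE, unfold AE_measure_pmf_iff, intro ballI nn_integral_cong_AE, unfold AE_measure_pmf_iff) (simp add: self)
  finally show ?thesis by simp
qed

text \<open>The density of the sample given the blocks, with the block signs averaged out. The
  prefactor is free of signs because every mean vector has squared norm
  \<open>norm_sq d \<theta>\<close>.\<close>

definition likelihood :: "nat \<Rightarrow> nat \<Rightarrow> (nat \<Rightarrow> nat) \<Rightarrow> (nat \<Rightarrow> real) \<Rightarrow> (nat \<Rightarrow> nat \<Rightarrow> real) \<Rightarrow> real" where
  "likelihood n d b \<theta> x = exp (- real n * norm_sq d \<theta> / 2) * (\<Prod>r\<le>n. cosh (block_dot n d b \<theta> r x))"

lemma likelihood_measurable [measurable]: "likelihood n d b \<theta> \<in> borel_measurable (noise n d)"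
  unfolding likelihood_def[abs_def] cosh_def by measurable

text \<open>For a fixed sign path the sample is shifted noise, with the density of
  \<open>noise_shift\<close>. Splitting the path into blocks and signs and averaging over the signs
  turns this density into \<open>likelihood\<close>.\<close>

lemma emeasure_sample_law:
  assumes \<delta>: "0 \<le> \<delta>" "\<delta> \<le> 1/2" and A: "A \<in> sets (sample_space n d)"
  shows "emeasure (sample_law n d \<delta> \<theta>) A
    = (\<integral>\<^sup>+b. \<integral>\<^sup>+x. ennreal (likelihood n d b \<theta> x) * indicator A x \<partial>noise n d \<partial>measure_pmf (block_law \<delta> n))"
proof -
  interpret N: prob_space "noise n d" by (rule prob_space_noise)
  have A': "A \<in> sets (noise n d)" using A by (simp add: sets_noise)
  define \<mu> where "\<mu> S i j = S i * \<theta> j" for S :: "nat \<Rightarrow> real" and i j :: nat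
  have obs: "observe n d \<theta> (S, Z) = (\<lambda>i\<in>{1..n}. \<lambda>j\<in>{..<d}. \<mu> S i j + Z i j)" for S Z
    by (simp add: observe_def \<mu>_def)
  have meas[measurable]: "(\<lambda>Z. \<lambda>i\<in>{1..n}. \<lambda>j\<in>{..<d}. \<mu> S i j + Z i j) \<in> measurable (noise n d) (sample_space n d)" for S
    unfolding sample_space_def vec_space_def
    by (intro measurable_restrict borel_measurable_add borel_measurable_const measurable_coordinate_noise)
  have chain: "chain_noise n d \<delta> = measure_pmf (sign_chain \<delta> n) \<Otimes>\<^sub>M noise n d"
    by (simp add: chain_noise_def noise_def)
  note obs_meas = observe_measurable[of n d \<theta> \<delta>]
  have "emeasure (sample_law n d \<delta> \<theta>) A = (\<integral>\<^sup>+\<omega>. indicator A (observe n d \<theta> \<omega>) \<partial>chain_noise n d \<delta>)"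
    using A unfolding sample_law_def
    by (subst nn_integral_distr[OF obs_meas, symmetric]) (auto simp: nn_integral_indicator)
  also have "\<dots> = (\<integral>\<^sup>+S. \<integral>\<^sup>+Z. indicator A (observe n d \<theta> (S, Z)) \<partial>noise n d \<partial>measure_pmf (sign_chain \<delta> n))"
    using measurable_compose[OF obs_meas borel_measurable_indicator[OF A]]
    unfolding chain by (rule N.nn_integral_fst[symmetric])
  also have "\<dots> = (\<integral>\<^sup>+S. \<integral>\<^sup>+x. ennreal (exp (pairing n d (\<mu> S) x - pairing n d (\<mu> S) (\<mu> S) / 2)) * indicator A x \<partial>noise n d \<partial>measure_pmf (sign_chain \<delta> n))"
  proof (rule nn_integral_cong)
    fix S
    have "(\<integral>\<^sup>+Z. indicator A (observe n d \<theta> (S, Z)) \<partial>noise n d)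
        = emeasure (distr (noise n d) (sample_space n d) (\<lambda>Z. \<lambda>i\<in>{1..n}. \<lambda>j\<in>{..<d}. \<mu> S i j + Z i j)) A"
      unfolding obs using A
      by (subst nn_integral_distr[OF meas, symmetric]) (auto simp: nn_integral_indicator)
    also have "\<dots> = (\<integral>\<^sup>+x. ennreal (exp (pairing n d (\<mu> S) x - pairing n d (\<mu> S) (\<mu> S) / 2)) * indicator A x \<partial>noise n d)"
      unfolding noise_shift using A' by (simp add: emeasure_density)
    finally show "(\<integral>\<^sup>+Z. indicator A (observe n d \<theta> (S, Z)) \<partial>noise n d) = \<dots>" .
  qed
  also have "\<dots> = (\<integral>\<^sup>+b. \<integral>\<^sup>+s. \<integral>\<^sup>+x. ennreal (exp (pairing n d (\<mu> (block_path n b s)) x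
      - pairing n d (\<mu> (block_path n b s)) (\<mu> (block_path n b s)) / 2)) * indicator A x
      \<partial>noise n d \<partial>measure_pmf (signs n) \<partial>measure_pmf (block_law \<delta> n))"
    by (simp add: sign_chain_eq_blocks[OF \<delta>])
  also have "\<dots> = (\<integral>\<^sup>+b. \<integral>\<^sup>+s. \<integral>\<^sup>+x. ennreal (exp (- real n * norm_sq d \<theta> / 2)) *
      ennreal (exp (\<Sum>r\<le>n. s r * block_dot n d b \<theta> r x)) * indicator A x
      \<partial>noise n d \<partial>measure_pmf (signs n) \<partial>measure_pmf (block_law \<delta> n))"
  proof (intro nn_integral_cong_AE, unfold AE_measure_pmf_iff, intro ballI nn_integral_cong_AE, unfold AE_measure_pmf_iff, intro ballI nn_integral_cong)
    fix b s x assume bs: "b \<in> set_pmf (block_law \<delta> n)" "s \<in> set_pmf (signs n)"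
    have b: "b ` {1..n} \<subseteq> {..n}" by (rule block_law_image[OF bs(1)])
    have "pairing n d (\<mu> (block_path n b s)) y = pairing n d (\<lambda>i j. s (b i) * \<theta> j) y" for y
      by (rule pairing_cong) (auto simp: \<mu>_def block_path_def)
    then have 1: "pairing n d (\<mu> (block_path n b s)) x = (\<Sum>r\<le>n. s r * block_dot n d b \<theta> r x)"
      using pairing_block[OF b, where s=s and d=d and v=\<theta> and x=x] by simp
    have "(s r)\<^sup>2 = 1" for r using signs_values[OF bs(2), of r] by auto
    then have "(s r * y) * (s r * y) = y\<^sup>2" for r y
      by (simp add: power2_eq_square[symmetric] power_mult_distrib)
    then have "pairing n d (\<mu> (block_path n b s)) (\<mu> (block_path n b s)) = real n * norm_sq d \<theta>"
      unfolding pairing_def \<mu>_def by (simp add: block_path_def norm_sq_def)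
    then show "ennreal (exp (pairing n d (\<mu> (block_path n b s)) x
      - pairing n d (\<mu> (block_path n b s)) (\<mu> (block_path n b s)) / 2)) * indicator A x
      = ennreal (exp (- real n * norm_sq d \<theta> / 2)) *
      ennreal (exp (\<Sum>r\<le>n. s r * block_dot n d b \<theta> r x)) * indicator A x"
      by (simp add: 1 ennreal_mult[symmetric] mult_exp_exp add.commute)
  qed
  also have "\<dots> = (\<integral>\<^sup>+b. \<integral>\<^sup>+x. \<integral>\<^sup>+s. ennreal (exp (- real n * norm_sq d \<theta> / 2)) *
      ennreal (exp (\<Sum>r\<le>n. s r * block_dot n d b \<theta> r x)) * indicator A x
      \<partial>measure_pmf (signs n) \<partial>noise n d \<partial>measure_pmf (block_law \<delta> n))"
    using A' by (intro nn_integral_cong nn_integral_pmf_swap) auto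
  also have "\<dots> = (\<integral>\<^sup>+b. \<integral>\<^sup>+x. ennreal (likelihood n d b \<theta> x) * indicator A x \<partial>noise n d \<partial>measure_pmf (block_law \<delta> n))"
    by (simp add: nn_integral_cmult nn_integral_multc nn_integral_signs_exp likelihood_def ennreal_mult prod_nonneg)
  finally show ?thesis .
qed

subsection \<open>Testing two parameters\<close>

text \<open>A Weierstrass product inequality: the terms of first order in y already account for at
  least the whole loss. In the induction step the loss \<open>y a * ?P\<close> is enlarged to
  \<open>y a * ?X\<close>.\<close>

lemma prod_diff_ge:
  fixes x y :: "'a \<Rightarrow> real"
  assumes "finite A" "\<And>r. r \<in> A \<Longrightarrow> 0 \<le> y r" "\<And>r. r \<in> A \<Longrightarrow> y r \<le> x r"
  shows "(\<Prod>r\<in>A. x r) - (\<Sum>r\<in>A. y r * (\<Prod>k\<in>A - {r}. x k)) \<le> (\<Prod>r\<in>A. x r - y r)"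
  using assms
proof (induction A rule: finite_induct)
  case (insert a A)
  let ?X = "\<Prod>r\<in>A. x r" and ?S = "\<Sum>r\<in>A. y r * (\<Prod>k\<in>A - {r}. x k)" and ?P = "\<Prod>r\<in>A. x r - y r"
  have "?P \<le> ?X"
    using insert.prems by (intro prod_mono) auto
  moreover have "?X - ?S \<le> ?P"
    using insert by simp
  moreover have a: "0 \<le> y a" "y a \<le> x a" using insert.prems by auto
  ultimately have "x a * (?X - ?S) - y a * ?X \<le> x a * ?P - y a * ?P"
    by (intro diff_mono mult_left_mono) auto
  moreover have "(\<Prod>k\<in>insert a A - {r}. x k) = x a * (\<Prod>k\<in>A - {r}. x k)" if "r \<in> A" for r
  proof -
    have "insert a A - {r} = insert a (A - {r})" using that insert.hyps by auto
    then show ?thesis using insert.hyps by simp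
  qed
  then have "(\<Sum>r\<in>A. y r * (\<Prod>k\<in>insert a A - {r}. x k)) = x a * ?S"
    by (simp add: sum_distrib_left mult_ac cong: sum.cong_simp)
  ultimately show ?case
    using insert.hyps by (simp add: algebra_simps)
qed simp

text \<open>The right side minus the left side is \<open>(cosh a - 1)\<^sup>2\<close>.\<close>

lemma sinh_sq_le: "(sinh a)\<^sup>2 \<le> 2 * cosh a * (cosh a - 1)" for a :: real
proof -
  have "(cosh a - 1) * (cosh a - 1) \<ge> 0" by simp
  then show ?thesis
    unfolding sinh_square_eq by (simp add: power2_eq_square algebra_simps)
qed

text \<open>
  The geometric mean of \<open>cosh (a + b)\<close> and \<open>cosh (a - b)\<close> is
  \<open>cosh a * cosh b * sqrt (1 - (tanh a * tanh b)\<^sup>2)\<close>, and \<open>sqrt (1 - z) \<ge> 1 - z\<close>. The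
  upper bound on \<open>(tanh a * tanh b)\<^sup>2\<close> is chosen so that every term is a
  combination of exponentials, with explicit Gaussian integrals.
\<close>

lemma min_prod_cosh_ge:
  fixes a b :: "'a \<Rightarrow> real"
  assumes "finite A"
  shows "(\<Prod>r\<in>A. cosh (a r) * cosh (b r))
      - (\<Sum>r\<in>A. 4 * ((cosh (a r) - 1) * (cosh (b r) - 1)) * (\<Prod>k\<in>A - {r}. cosh (a k) * cosh (b k)))
      - ((\<Prod>r\<in>A. cosh (a r + b r)) + (\<Prod>r\<in>A. cosh (a r - b r))) / 4
    \<le> min (\<Prod>r\<in>A. cosh (a r + b r)) (\<Prod>r\<in>A. cosh (a r - b r))"
proof -
  define x where "x r = cosh (a r) * cosh (b r)" for r
  \<comment> \<open>With this choice \<open>x r - y r = x r * (1 - z)\<close> for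
    \<open>z = (tanh (a r) * tanh (b r))\<^sup>2\<close>, the lower bound on the geometric
    mean.\<close>
  define y where "y r = (sinh (a r))\<^sup>2 * (sinh (b r))\<^sup>2 / x r" for r
  define P where "P = (\<Prod>r\<in>A. cosh (a r + b r))"
  define Q where "Q = (\<Prod>r\<in>A. cosh (a r - b r))"
  define L where "L = (\<Prod>r\<in>A. x r - y r)"
  have x: "0 < x r" for r by (simp add: x_def cosh_real_pos)
  have xy: "x r * y r = (sinh (a r))\<^sup>2 * (sinh (b r))\<^sup>2" for r
    using x[of r] by (simp add: y_def)
  have y0: "0 \<le> y r" for r
    using x[of r] by (simp add: y_def)
  have "x r * y r \<le> x r * (4 * ((cosh (a r) - 1) * (cosh (b r) - 1)))" for r
  proof -
    have "(sinh (a r))\<^sup>2 * (sinh (b r))\<^sup>2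
        \<le> (2 * cosh (a r) * (cosh (a r) - 1)) * (2 * cosh (b r) * (cosh (b r) - 1))"
      by (intro mult_mono sinh_sq_le) (auto simp: cosh_real_ge_1)
    also have "\<dots> = x r * (4 * ((cosh (a r) - 1) * (cosh (b r) - 1)))"
      by (simp add: x_def)
    finally show ?thesis unfolding xy .
  qed
  then have yb: "y r \<le> 4 * ((cosh (a r) - 1) * (cosh (b r) - 1))" for r
    using x[of r] by (rule mult_left_le_imp_le)
  have "x r * y r \<le> x r * x r" for r
  proof -
    have "(sinh (a r))\<^sup>2 * (sinh (b r))\<^sup>2 \<le> (cosh (a r))\<^sup>2 * (cosh (b r))\<^sup>2"
      by (intro mult_mono) (auto simp: cosh_square_eq)
    also have "\<dots> = x r * x r" by (simp add: x_def power2_eq_square)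
    finally show ?thesis unfolding xy .
  qed
  then have yx: "y r \<le> x r" for r
    using x[of r] by (rule mult_left_le_imp_le)
  have "(\<Prod>r\<in>A. x r) - (\<Sum>r\<in>A. 4 * ((cosh (a r) - 1) * (cosh (b r) - 1)) * (\<Prod>k\<in>A - {r}. x k))
      \<le> (\<Prod>r\<in>A. x r) - (\<Sum>r\<in>A. y r * (\<Prod>k\<in>A - {r}. x k))"
    by (intro diff_left_mono sum_mono mult_right_mono yb prod_nonneg ballI less_imp_le[OF x])
  also have "\<dots> \<le> L"
    unfolding L_def by (intro prod_diff_ge assms y0 yx)
  finally have "(\<Prod>r\<in>A. x r) - (\<Sum>r\<in>A. 4 * ((cosh (a r) - 1) * (cosh (b r) - 1)) * (\<Prod>k\<in>A - {r}. x k)) \<le> L" .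
  \<comment> \<open>L is at most the geometric mean of P and Q, hence at most
    \<open>P + Q / 4\<close> and \<open>Q + P / 4\<close> by the inequality of arithmetic and
    geometric means. After normalisation P and Q have integral 1, so the weight 1/4 costs one half
    in total.\<close>
  moreover have "L - (P + Q) / 4 \<le> min P Q"
  proof -
    have "(x r - y r)\<^sup>2 \<le> cosh (a r + b r) * cosh (a r - b r)" for r
    proof -
      have "cosh (a r + b r) * cosh (a r - b r) = (x r)\<^sup>2 - x r * y r"
        unfolding xy unfolding cosh_add cosh_diff x_def by (simp add: power2_eq_square algebra_simps)
      moreover have "y r * y r \<le> x r * y r"
        by (intro mult_right_mono yx y0)
      ultimately show ?thesis by (simp add: power2_eq_square algebra_simps)
    qed
    then have "L\<^sup>2 \<le> P * Q"
      unfolding L_def P_def Q_def prod_power_distrib prod.distrib[symmetric]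
      by (intro prod_mono) auto
    moreover have PQ: "0 \<le> P" "0 \<le> Q"
      unfolding P_def Q_def by (auto intro!: prod_nonneg simp: cosh_real_nonneg)
    have amgm: "p * q \<le> (p + q / 4)\<^sup>2" for p q :: real
    proof -
      have "0 \<le> (p - q / 4)\<^sup>2" by simp
      then show ?thesis by (simp add: power2_eq_square algebra_simps)
    qed
    from amgm[of P Q] amgm[of Q P] have "P * Q \<le> (P + Q / 4)\<^sup>2" "P * Q \<le> (Q + P / 4)\<^sup>2"
      by (simp_all add: mult.commute)
    ultimately have "L\<^sup>2 \<le> (P + Q / 4)\<^sup>2" "L\<^sup>2 \<le> (Q + P / 4)\<^sup>2" by linarith+
    then have "L \<le> P + Q / 4" "L \<le> Q + P / 4"
      using PQ by (auto intro: power2_le_imp_le)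
    with PQ show ?thesis by (auto simp: min_def add_divide_distrib)
  qed
  ultimately show ?thesis
    unfolding x_def P_def Q_def by linarith
qed

lemma norm_sq_add:
  assumes "(\<Sum>j\<in>{..<d}. u j * w j) = 0" "\<forall>j<d. \<theta> j = u j + w j"
  shows "norm_sq d \<theta> = norm_sq d u + norm_sq d w"
proof -
  have "norm_sq d \<theta> = (\<Sum>j\<in>{..<d}. (u j)\<^sup>2 + (w j)\<^sup>2 + 2 * (u j * w j))"
    unfolding norm_sq_def by (intro sum.cong refl) (simp add: assms(2)[rule_format] power2_eq_square algebra_simps)
  then show ?thesis
    by (simp only: sum.distrib sum_distrib_left[symmetric] assms(1) norm_sq_def)
qed

lemma block_dot_add:
  assumes "\<forall>j<d. \<theta> j = u j + w j"
  shows "block_dot n d b \<theta> r x = block_dot n d b u r x + block_dot n d b w r x"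
  unfolding block_dot_def sum.distrib[symmetric]
  by (intro sum.cong refl) (simp add: assms[rule_format] distrib_right)

lemma block_dot_uminus: "block_dot n d b (\<lambda>j. - w j) r x = - block_dot n d b w r x"
  unfolding block_dot_def sum_negf[symmetric] by simp

lemma sum_block_size:
  assumes "b ` {1..n} \<subseteq> {..n}"
  shows "(\<Sum>r\<le>n. block_size n b r) = real n"
  using sum_blocks[OF assms, where h = "\<lambda>_. 1 :: real"] by (simp add: block_size_def)

lemma sum_block_size_sq:
  assumes "b ` {1..n} \<subseteq> {..n}"
  shows "(\<Sum>r\<le>n. (block_size n b r)\<^sup>2) = block_pairs n b"
proof -
  have "block_pairs n b = (\<Sum>i\<in>{1..n}. block_size n b (b i))"
    unfolding block_pairs_def block_size_def
    by (intro sum.cong refl) (auto intro!: arg_cong[where f = card])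
  also have "\<dots> = (\<Sum>r\<le>n. \<Sum>i\<in>{i\<in>{1..n}. b i = r}. block_size n b (b i))"
    by (rule sum_blocks[OF assms])
  also have "\<dots> = (\<Sum>r\<le>n. (block_size n b r)\<^sup>2)"
    by (intro sum.cong refl) (simp add: block_size_def power2_eq_square)
  finally show ?thesis by simp
qed

text \<open>The Bochner form of the integral is needed because signed combinations of these products
  are integrated below.\<close>

lemma has_bochner_integral_cosh_prod:
  assumes "b ` {1..n} \<subseteq> {..n}" "(\<Sum>j\<in>{..<d}. u j * w j) = 0"
  shows "has_bochner_integral (noise n d)
     (\<lambda>x. \<Prod>r\<le>n. cosh (\<alpha> r * block_dot n d b u r x) * cosh (\<beta> r * block_dot n d b w r x))
     (exp ((\<Sum>r\<le>n. block_size n b r * ((\<alpha> r)\<^sup>2 * norm_sq d u + (\<beta> r)\<^sup>2 * norm_sq d w)) / 2))"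
proof (rule has_bochner_integral_nn_integral)
  show "(\<lambda>x. \<Prod>r\<le>n. cosh (\<alpha> r * block_dot n d b u r x) * cosh (\<beta> r * block_dot n d b w r x)) \<in> borel_measurable (noise n d)"
    unfolding cosh_def by measurable
qed (auto intro!: prod_nonneg simp: nn_integral_cosh_prod[OF assms])

lemma has_bochner_integral_likelihood:
  assumes b: "b ` {1..n} \<subseteq> {..n}"
  shows "has_bochner_integral (noise n d) (likelihood n d b \<theta>) 1"
proof -
  \<comment> \<open>The zero vector serves as the second direction, with weight 0, so its factors
    are \<open>cosh 0 = 1\<close>.\<close>
  have "(\<Sum>j\<in>{..<d}. \<theta> j * 0) = 0" by simp
  from has_bochner_integral_mult_right[OF has_bochner_integral_cosh_prod[OF b this, where
      \<alpha> = "\<lambda>_. 1" and \<beta> = "\<lambda>_. 0"], of "exp (- real n * norm_sq d \<theta> / 2)"]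
  show ?thesis
    by (simp add: likelihood_def[abs_def] norm_sq_def[of d "\<lambda>_. 0"] sum_distrib_right[symmetric]
        sum_block_size[OF b] mult_exp_exp)
qed

text \<open>The sum of the two error integrands is pointwise at least the minimum of the two
  likelihoods, and \<open>min_prod_cosh_ge\<close> bounds that minimum below by an explicitly
  integrable function. Switching off the u-factor of a block of size k multiplies the normalised
  Gaussian integral by \<open>exp (- k * norm_sq d u / 2)\<close>, and likewise for w. This produces
  the factors of the form 1 - exp.\<close>

lemma test_error_given_blocks:
  assumes b: "b ` {1..n} \<subseteq> {..n}"
    and orth: "(\<Sum>j\<in>{..<d}. u j * w j) = 0"
    and \<theta>: "\<forall>j<d. \<theta> j = u j + w j"
    and \<theta>': "\<forall>j<d. \<theta>' j = u j - w j"
    and A: "A \<in> sets (noise n d)"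
  shows "ennreal (1/2 - (\<Sum>r\<le>n. 4 * ((1 - exp (- block_size n b r * norm_sq d u / 2)) * (1 - exp (- block_size n b r * norm_sq d w / 2)))))
    \<le> (\<integral>\<^sup>+x. ennreal (likelihood n d b \<theta> x) * indicator A x \<partial>noise n d)
      + (\<integral>\<^sup>+x. ennreal (likelihood n d b \<theta>' x) * indicator (space (noise n d) - A) x \<partial>noise n d)"
proof -
  define N1 N2 where "N1 = norm_sq d u" and "N2 = norm_sq d w"
  define K where "K = exp (- real n * (N1 + N2) / 2)"
  define a c where "a r x = block_dot n d b u r x" and "c r x = block_dot n d b w r x" for r x
  define F where "F \<alpha> \<beta> x = (\<Prod>r\<le>n. cosh (\<alpha> r * a r x) * cosh (\<beta> r * c r x))" for \<alpha> \<beta> x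
  let ?one = "\<lambda>_::nat. 1::real"
  let ?off = "\<lambda>r. ?one(r := 0)"
  \<comment> \<open>K times the lower bound of \<open>min_prod_cosh_ge\<close>. The product of
    \<open>cosh (a r x) - 1\<close> and \<open>cosh (c r x) - 1\<close> is multiplied out into four
    terms, in which \<open>?off r\<close> deletes the factor of block r.\<close>
  define H where "H x = K * F ?one ?one x
     - (\<Sum>r\<le>n. 4 * (K * F ?one ?one x - K * F (?off r) ?one x - K * F ?one (?off r) x + K * F (?off r) (?off r) x))
     - (likelihood n d b \<theta> x + likelihood n d b \<theta>' x) / 4" for x
  define G where "G x = likelihood n d b \<theta> x * indicator A x
      + likelihood n d b \<theta>' x * indicator (space (noise n d) - A) x" for x
  note [simp] = N1_def[symmetric] N2_def[symmetric]
  have \<theta>'': "\<forall>j<d. \<theta>' j = u j + (- w j)" using \<theta>' by simp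
  have orth': "(\<Sum>j\<in>{..<d}. u j * - w j) = 0" using orth by (simp add: sum_negf)
  have norm_neg: "norm_sq d (\<lambda>j. - w j) = norm_sq d w" by (simp add: norm_sq_def)
  have L: "likelihood n d b \<theta> x = K * (\<Prod>r\<le>n. cosh (a r x + c r x))"
    "likelihood n d b \<theta>' x = K * (\<Prod>r\<le>n. cosh (a r x - c r x))" for x
    unfolding likelihood_def K_def a_def c_def
    by (simp_all add: block_dot_add[OF \<theta>] block_dot_add[OF \<theta>''] block_dot_uminus
        norm_sq_add[OF orth \<theta>] norm_sq_add[OF orth' \<theta>''] norm_neg)
  have HF: "has_bochner_integral (noise n d) (\<lambda>x. K * F \<alpha> \<beta> x)
      (exp (((\<Sum>r\<le>n. block_size n b r * ((\<alpha> r)\<^sup>2 * N1 + (\<beta> r)\<^sup>2 * N2)) - real n * (N1 + N2)) / 2))" for \<alpha> \<beta>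
    using has_bochner_integral_mult_right[OF has_bochner_integral_cosh_prod[OF b orth, where \<alpha>=\<alpha> and \<beta>=\<beta>], of K]
    by (simp add: F_def a_def c_def K_def mult_exp_exp diff_divide_distrib)
  \<comment> \<open>The normalisation is spread over the blocks so that every block with both
    weights equal to 1 drops out.\<close>
  have size: "(\<Sum>r\<le>n. block_size n b r * ((\<alpha> r)\<^sup>2 * N1 + (\<beta> r)\<^sup>2 * N2)) - real n * (N1 + N2)
      = (\<Sum>r\<le>n. block_size n b r * (((\<alpha> r)\<^sup>2 - 1) * N1 + ((\<beta> r)\<^sup>2 - 1) * N2))" for \<alpha> \<beta>
    unfolding sum_block_size[OF b, symmetric] sum_distrib_right sum_subtractf[symmetric]
    by (intro sum.cong refl) (simp add: algebra_simps)
  have one_off: "(\<Sum>k\<le>n. block_size n b k * ((((?one(r := z)) k)\<^sup>2 - 1) * N1 + (((?one(r := z')) k)\<^sup>2 - 1) * N2))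
      = block_size n b r * ((z\<^sup>2 - 1) * N1 + (z'\<^sup>2 - 1) * N2)" if "r \<le> n" for r z z'
    using that by (subst sum.remove[of _ r]) auto
  have I: "has_bochner_integral (noise n d) (\<lambda>x. K * F (?one(r := z)) (?one(r := z')) x)
      (exp (block_size n b r * ((z\<^sup>2 - 1) * N1 + (z'\<^sup>2 - 1) * N2) / 2))" if "r \<le> n" for r z z'
    using HF[of "?one(r := z)" "?one(r := z')"] unfolding size one_off[OF that] .
  have I11: "has_bochner_integral (noise n d) (\<lambda>x. K * F ?one ?one x) 1"
    using I[of 0 1 1] fun_upd_triv[of ?one 0] by simp
  let ?k = "block_size n b"
  have "has_bochner_integral (noise n d) H (1
     - (\<Sum>r\<le>n. 4 * (1 - exp (?k r * ((0\<^sup>2 - 1) * N1 + (1\<^sup>2 - 1) * N2) / 2) - exp (?k r * ((1\<^sup>2 - 1) * N1 + (0\<^sup>2 - 1) * N2) / 2)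
         + exp (?k r * ((0\<^sup>2 - 1) * N1 + (0\<^sup>2 - 1) * N2) / 2))) - (1 + 1) / 4)"
    unfolding H_def[abs_def]
  proof (intro has_bochner_integral_diff has_bochner_integral_sum has_bochner_integral_mult_right
      has_bochner_integral_add has_bochner_integral_divide has_bochner_integral_likelihood b I11)
    fix r assume "r \<in> {..n}"
    then have r: "r \<le> n" by simp
    have triv: "?one(r := 1) = ?one" by auto
    show "has_bochner_integral (noise n d) (\<lambda>x. K * F (?off r) ?one x) (exp (?k r * ((0\<^sup>2 - 1) * N1 + (1\<^sup>2 - 1) * N2) / 2))"
      using I[OF r, of 0 1] unfolding triv .
    show "has_bochner_integral (noise n d) (\<lambda>x. K * F ?one (?off r) x) (exp (?k r * ((1\<^sup>2 - 1) * N1 + (0\<^sup>2 - 1) * N2) / 2))"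
      using I[OF r, of 1 0] unfolding triv .
    show "has_bochner_integral (noise n d) (\<lambda>x. K * F (?off r) (?off r) x) (exp (?k r * ((0\<^sup>2 - 1) * N1 + (0\<^sup>2 - 1) * N2) / 2))"
      using I[OF r, of 0 0] .
  qed
  moreover have "1 - exp (?k r * ((0\<^sup>2 - 1) * N1 + (1\<^sup>2 - 1) * N2) / 2) - exp (?k r * ((1\<^sup>2 - 1) * N1 + (0\<^sup>2 - 1) * N2) / 2)
         + exp (?k r * ((0\<^sup>2 - 1) * N1 + (0\<^sup>2 - 1) * N2) / 2)
     = (1 - exp (- ?k r * N1 / 2)) * (1 - exp (- ?k r * N2 / 2))" for r
  proof -
    have "?k r * ((0\<^sup>2 - 1) * N1 + (1\<^sup>2 - 1) * N2) / 2 = - ?k r * N1 / 2"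
      "?k r * ((1\<^sup>2 - 1) * N1 + (0\<^sup>2 - 1) * N2) / 2 = - ?k r * N2 / 2"
      "?k r * ((0\<^sup>2 - 1) * N1 + (0\<^sup>2 - 1) * N2) / 2 = - ?k r * N1 / 2 + - ?k r * N2 / 2"
      by (simp_all add: field_simps)
    then show ?thesis
      by (simp only: exp_add) (simp only: left_diff_distrib right_diff_distrib mult_1_left mult_1_right)
  qed
  ultimately have "has_bochner_integral (noise n d) H
      (1 - (\<Sum>r\<le>n. 4 * ((1 - exp (- ?k r * N1 / 2)) * (1 - exp (- ?k r * N2 / 2)))) - (1 + 1) / 4)"
    by (simp only:)
  moreover have "1 - s - (1 + 1) / 4 = 1/2 - s" for s :: real
    by simp
  ultimately have HH: "has_bochner_integral (noise n d) H
      (1/2 - (\<Sum>r\<le>n. 4 * ((1 - exp (- ?k r * N1 / 2)) * (1 - exp (- ?k r * N2 / 2)))))"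
    by (simp only:)
  have lik0: "0 \<le> likelihood n d b \<theta>'' x" for \<theta>'' x
    unfolding likelihood_def by (intro mult_nonneg_nonneg prod_nonneg) auto
  have "integrable (noise n d) (likelihood n d b \<theta>'')" for \<theta>''
    using has_bochner_integral_likelihood[OF b] by (rule integrable.intros)
  then have intG: "integrable (noise n d) G"
    unfolding G_def[abs_def] using A
    by (intro Bochner_Integration.integrable_add integrable_real_mult_indicator sets.compl_sets)
  have HG: "H x \<le> G x" if "x \<in> space (noise n d)" for x
  proof -
    have "F ?one ?one x - F (?off r) ?one x - F ?one (?off r) x + F (?off r) (?off r) x
      = ((cosh (a r x) - 1) * (cosh (c r x) - 1)) * (\<Prod>k\<in>{..n} - {r}. cosh (a k x) * cosh (c k x))"
      if "r \<in> {..n}" for r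
    proof -
      have *: "F (?one(r := z)) (?one(r := z')) x
          = cosh (z * a r x) * cosh (z' * c r x) * (\<Prod>k\<in>{..n} - {r}. cosh (a k x) * cosh (c k x))" for z z'
        unfolding F_def using that by (subst prod.remove[of _ r]) auto
      have triv: "?one(r := 1) = ?one" by auto
      show ?thesis
        using *[of 1 1] *[of 0 1] *[of 1 0] *[of 0 0] unfolding triv by (simp add: algebra_simps)
    qed
    then have "4 * (K * F ?one ?one x - K * F (?off r) ?one x - K * F ?one (?off r) x + K * F (?off r) (?off r) x)
      = K * (4 * ((cosh (a r x) - 1) * (cosh (c r x) - 1)) * (\<Prod>k\<in>{..n} - {r}. cosh (a k x) * cosh (c k x)))"
      if "r \<in> {..n}" for r
      using that by (simp only: right_diff_distrib[of K, symmetric] distrib_left[of K, symmetric] mult.left_commute[of 4 K] mult.assoc)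
    then have sum: "(\<Sum>r\<le>n. 4 * (K * F ?one ?one x - K * F (?off r) ?one x - K * F ?one (?off r) x + K * F (?off r) (?off r) x))
      = K * (\<Sum>r\<le>n. 4 * ((cosh (a r x) - 1) * (cosh (c r x) - 1)) * (\<Prod>k\<in>{..n} - {r}. cosh (a k x) * cosh (c k x)))"
      unfolding sum_distrib_left by (intro sum.cong refl)
    have "H x = K * ((\<Prod>r\<le>n. cosh (a r x) * cosh (c r x))
      - (\<Sum>r\<le>n. 4 * ((cosh (a r x) - 1) * (cosh (c r x) - 1)) * (\<Prod>k\<in>{..n} - {r}. cosh (a k x) * cosh (c k x)))
      - ((\<Prod>r\<le>n. cosh (a r x + c r x)) + (\<Prod>r\<le>n. cosh (a r x - c r x))) / 4)"
      unfolding H_def L sum by (simp add: F_def right_diff_distrib distrib_left)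
    also have "\<dots> \<le> K * min (\<Prod>r\<le>n. cosh (a r x + c r x)) (\<Prod>r\<le>n. cosh (a r x - c r x))"
      by (intro mult_left_mono min_prod_cosh_ge[where a = "\<lambda>r. a r x" and b = "\<lambda>r. c r x"]) (simp_all add: K_def)
    also have "\<dots> = min (likelihood n d b \<theta> x) (likelihood n d b \<theta>' x)"
      unfolding L by (simp add: min_mult_distrib_left K_def)
    also have "\<dots> \<le> G x"
      using that by (auto simp: G_def indicator_def)
    finally show ?thesis .
  qed
  have "(1/2 - (\<Sum>r\<le>n. 4 * ((1 - exp (- ?k r * N1 / 2)) * (1 - exp (- ?k r * N2 / 2))))) \<le> (\<integral>x. G x \<partial>noise n d)"
    using integral_mono[OF integrable.intros[OF HH] intG HG] has_bochner_integral_integral_eq[OF HH]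
    by (simp only:)
  moreover have G0: "0 \<le> G x" for x
    using lik0 by (simp add: G_def)
  ultimately have "ennreal (1/2 - (\<Sum>r\<le>n. 4 * ((1 - exp (- ?k r * N1 / 2)) * (1 - exp (- ?k r * N2 / 2))))) \<le> (\<integral>\<^sup>+x. ennreal (G x) \<partial>noise n d)"
    using nn_integral_eq_integral[OF intG] G0 by (simp add: ennreal_leI)
  also have "\<dots> = (\<integral>\<^sup>+x. ennreal (likelihood n d b \<theta> x) * indicator A x
      + ennreal (likelihood n d b \<theta>' x) * indicator (space (noise n d) - A) x \<partial>noise n d)"
    unfolding G_def by (intro nn_integral_cong) (simp split: split_indicator)
  also have "\<dots> = (\<integral>\<^sup>+x. ennreal (likelihood n d b \<theta> x) * indicator A x \<partial>noise n d)
      + (\<integral>\<^sup>+x. ennreal (likelihood n d b \<theta>' x) * indicator (space (noise n d) - A) x \<partial>noise n d)"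
    using A by (intro nn_integral_add borel_measurable_times_ennreal borel_measurable_indicator sets.compl_sets
        measurable_compose[OF likelihood_measurable measurable_ennreal])
  finally show ?thesis unfolding N1_def N2_def .
qed

lemma one_minus_exp_bounds:
  assumes "0 \<le> (z::real)"
  shows "0 \<le> 1 - exp (- z)" "1 - exp (- z) \<le> z" "1 - exp (- z) \<le> 1"
  using assms exp_ge_add_one_self[of "- z"] by auto

text \<open>Averaging over the blocks, it suffices that the mean cost is at most 1/4. The two
  alternatives in \<open>small\<close> come from bounding 1 - exp(-z) by z in both factors, which
  gives squared block sizes, or by 1 in the u-factor, which gives block sizes summing to n.\<close>

lemma test_error:
  assumes \<delta>: "0 < \<delta>" "\<delta> \<le> 1/2"
    and orth: "(\<Sum>j\<in>{..<d}. u j * w j) = 0"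
    and \<theta>: "\<forall>j<d. \<theta> j = u j + w j"
    and \<theta>': "\<forall>j<d. \<theta>' j = u j - w j"
    and small: "norm_sq d u * norm_sq d w * real n / \<delta> \<le> 1/4 \<or> 2 * real n * norm_sq d w \<le> 1/4"
    and A: "A \<in> sets (sample_space n d)"
  shows "ennreal (1/4) \<le> emeasure (sample_law n d \<delta> \<theta>) A + emeasure (sample_law n d \<delta> \<theta>') (space (sample_space n d) - A)"
proof -
  define N1 N2 where "N1 = norm_sq d u" and "N2 = norm_sq d w"
  have N: "0 \<le> N1" "0 \<le> N2" by (simp_all add: N1_def N2_def norm_sq_def sum_nonneg)
  define cost where "cost b = (\<Sum>r\<le>n. 4 * ((1 - exp (- block_size n b r * N1 / 2)) * (1 - exp (- block_size n b r * N2 / 2))))" for b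
  have A': "A \<in> sets (noise n d)" and sp: "space (noise n d) = space (sample_space n d)"
    using A by (simp_all add: sets_noise sets_eq_imp_space_eq[OF sets_noise])
  let ?M = "measure_pmf (block_law \<delta> n)"
  let ?I = "\<lambda>b. \<integral>\<^sup>+x. ennreal (likelihood n d b \<theta> x) * indicator A x \<partial>noise n d"
  let ?J = "\<lambda>b. \<integral>\<^sup>+x. ennreal (likelihood n d b \<theta>' x) * indicator (space (noise n d) - A) x \<partial>noise n d"
  have k0: "0 \<le> block_size n b r" for b r by (simp add: block_size_def)
  have z: "- block_size n b r * v / 2 = - (block_size n b r * v / 2)" for b r v by simp
  note bounds = one_minus_exp_bounds[of "block_size n b r * v / 2" for b r v, folded z]
  have cost0: "0 \<le> cost b" for b
    unfolding cost_def using N k0 by (intro sum_nonneg mult_nonneg_nonneg bounds) auto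
  have cost: "measure_pmf.expectation (block_law \<delta> n) cost \<le> 1/4"
    using small
  proof
    assume small: "norm_sq d u * norm_sq d w * real n / \<delta> \<le> 1/4"
    have "cost b \<le> N1 * N2 * block_pairs n b" if "b \<in> set_pmf (block_law \<delta> n)" for b
    proof -
      have "cost b \<le> (\<Sum>r\<le>n. 4 * ((block_size n b r * N1 / 2) * (block_size n b r * N2 / 2)))"
        unfolding cost_def using N k0 by (intro sum_mono mult_left_mono mult_mono bounds) auto
      also have "\<dots> = N1 * N2 * block_pairs n b"
        unfolding sum_block_size_sq[OF block_law_image[OF that], symmetric] sum_distrib_left
        by (intro sum.cong refl) (simp add: power2_eq_square)
      finally show ?thesis .
    qed
    then have "measure_pmf.expectation (block_law \<delta> n) cost \<le> measure_pmf.expectation (block_law \<delta> n) (\<lambda>b. N1 * N2 * block_pairs n b)"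
      by (intro integral_mono_AE integrable_measure_pmf_finite) (auto simp: AE_measure_pmf_iff)
    also have "\<dots> = N1 * N2 * measure_pmf.expectation (block_law \<delta> n) (block_pairs n)"
      by simp
    also have "\<dots> \<le> N1 * N2 * (real n / \<delta>)"
      using N expectation_block_pairs[OF \<delta>] by (intro mult_left_mono) auto
    finally show ?thesis using small unfolding N1_def N2_def times_divide_eq_right by (rule order_trans)
  next
    assume small: "2 * real n * norm_sq d w \<le> 1/4"
    have "cost b \<le> 1/4" if "b \<in> set_pmf (block_law \<delta> n)" for b
    proof -
      have "cost b \<le> (\<Sum>r\<le>n. 4 * (1 * (block_size n b r * N2 / 2)))"
        unfolding cost_def using N k0 by (intro sum_mono mult_left_mono mult_mono bounds) auto
      also have "\<dots> = 2 * (\<Sum>r\<le>n. block_size n b r) * N2"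
        by (simp add: sum_distrib_left sum_distrib_right mult_ac)
      finally show ?thesis using small unfolding sum_block_size[OF block_law_image[OF that]] by (simp add: N2_def)
    qed
    then have "measure_pmf.expectation (block_law \<delta> n) cost \<le> measure_pmf.expectation (block_law \<delta> n) (\<lambda>b. 1/4)"
      by (intro integral_mono_AE integrable_measure_pmf_finite) (auto simp: AE_measure_pmf_iff)
    then show ?thesis by simp
  qed
  \<comment> \<open>\<open>ennreal\<close> sends negative reals to 0, so the cost is added on the
    right instead of being subtracted on the left; its mean is cancelled at the end.\<close>
  have "ennreal (1/4) + ennreal (1/4) = (\<integral>\<^sup>+b. ennreal (1/2) \<partial>?M)"
    by (simp add: ennreal_plus[symmetric] del: ennreal_plus)
  also have "\<dots> \<le> (\<integral>\<^sup>+b. (?I b + ?J b) + ennreal (cost b) \<partial>?M)"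
  proof (intro nn_integral_mono_AE, unfold AE_measure_pmf_iff, intro ballI)
    fix b assume b: "b \<in> set_pmf (block_law \<delta> n)"
    have "ennreal (1/2) \<le> ennreal (1/2 - cost b) + ennreal (cost b)"
    proof (cases "cost b \<le> 1/2")
      case True
      then show ?thesis using cost0[of b] by (simp add: ennreal_plus[symmetric] del: ennreal_plus)
    next
      case False
      then have "ennreal (1/2) \<le> ennreal (cost b)" by (intro ennreal_leI) simp
      then show ?thesis by (rule add_increasing[OF zero_le])
    qed
    also have "\<dots> \<le> (?I b + ?J b) + ennreal (cost b)"
      using test_error_given_blocks[OF block_law_image[OF b] orth \<theta> \<theta>' A']
      by (intro add_right_mono) (simp_all add: cost_def N1_def N2_def)
    finally show "ennreal (1/2) \<le> (?I b + ?J b) + ennreal (cost b)" .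
  qed
  also have "\<dots> = (\<integral>\<^sup>+b. ?I b \<partial>?M) + (\<integral>\<^sup>+b. ?J b \<partial>?M) + (\<integral>\<^sup>+b. ennreal (cost b) \<partial>?M)"
    by (simp add: nn_integral_add)
  also have "(\<integral>\<^sup>+b. ennreal (cost b) \<partial>?M) = ennreal (measure_pmf.expectation (block_law \<delta> n) cost)"
    by (intro nn_integral_eq_integral integrable_measure_pmf_finite) (auto simp: cost0)
  also have "ennreal (measure_pmf.expectation (block_law \<delta> n) cost) \<le> ennreal (1/4)" using cost by (intro ennreal_leI)
  also have "(\<integral>\<^sup>+b. ?I b \<partial>?M) = emeasure (sample_law n d \<delta> \<theta>) A"
    using \<delta> A by (subst emeasure_sample_law) auto
  also have "(\<integral>\<^sup>+b. ?J b \<partial>?M) = emeasure (sample_law n d \<delta> \<theta>') (space (sample_space n d) - A)"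
    using \<delta> A by (subst emeasure_sample_law) (auto simp: sp)
  finally have "ennreal (1/4) + ennreal (1/4) \<le> ennreal (1/4) + (emeasure (sample_law n d \<delta> \<theta>) A + emeasure (sample_law n d \<delta> \<theta>') (space (sample_space n d) - A))"
    by (simp only: add_ac add_mono)
  then show ?thesis
    by (subst (asm) ennreal_add_left_cancel_le) auto
qed

subsection \<open>Reduction to testing\<close>

text \<open>The vertices of the cube are paired along the edges in direction j.\<close>

lemma sum_Pow_split:
  assumes "finite J" "j \<in> J"
  shows "(\<Sum>V\<in>Pow J. f V) = (\<Sum>V\<in>Pow (J - {j}). f V + f (insert j V))"
proof -
  have J: "J = insert j (J - {j})" using assms(2) by auto
  have inj: "inj_on (insert j) (Pow (J - {j}))"
    by (auto simp: inj_on_def)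
  have "Pow J = Pow (J - {j}) \<union> insert j ` Pow (J - {j})"
    by (subst J, subst Pow_insert) simp
  then have "sum f (Pow J) = sum f (Pow (J - {j})) + sum f (insert j ` Pow (J - {j}))"
    using assms(1) by (simp add: sum.union_disjoint[symmetric] disjoint_iff image_iff) (auto intro!: sum.union_disjoint)
  also have "sum f (insert j ` Pow (J - {j})) = (\<Sum>V\<in>Pow (J - {j}). f (insert j V))"
    by (simp add: sum.reindex[OF inj])
  finally show ?thesis by (simp add: sum.distrib)
qed

text \<open>A vertex is coded by the set of its positive cube coordinates. Coordinate 0 is reserved:
  it brings the norm up to t and breaks the symmetry between a parameter and its negative.\<close>

definition cube_point :: "nat \<Rightarrow> real \<Rightarrow> real \<Rightarrow> nat set \<Rightarrow> nat \<Rightarrow> real" where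
  "cube_point d a \<epsilon> V = (\<lambda>j\<in>{..<d}. if j = 0 then a else if j \<in> V then \<epsilon> else - \<epsilon>)"

text \<open>
  Coordinate 0 is nonnegative at every cube point, so an estimate is first negated if necessary to
  make its coordinate 0 nonnegative; this leaves the loss unchanged.
\<close>

definition guess :: "(nat \<Rightarrow> real) \<Rightarrow> nat \<Rightarrow> bool" where
  "guess y j \<longleftrightarrow> (if 0 \<le> y 0 then 0 \<le> y j else y j \<le> 0)"

lemma lessThan_split: "1 \<le> d \<Longrightarrow> {..<d} = insert 0 {1..<d}" for d :: nat
  by auto

lemma norm_sq_cube_point:
  assumes "1 \<le> d"
  shows "norm_sq d (cube_point d a \<epsilon> V) = a\<^sup>2 + real (d - 1) * \<epsilon>\<^sup>2"
proof -
  have "norm_sq d (cube_point d a \<epsilon> V) = (\<Sum>j\<in>{..<d}. if j = 0 then a\<^sup>2 else \<epsilon>\<^sup>2)"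
    unfolding norm_sq_def by (intro sum.cong refl) (auto simp: cube_point_def)
  also have "\<dots> = a\<^sup>2 + (\<Sum>j\<in>{1..<d}. if j = 0 then a\<^sup>2 else \<epsilon>\<^sup>2)"
    unfolding lessThan_split[OF assms] by (subst sum.insert) auto
  also have "(\<Sum>j\<in>{1..<d}. if j = 0 then a\<^sup>2 else \<epsilon>\<^sup>2) = (\<Sum>j\<in>{1..<d}. \<epsilon>\<^sup>2)"
    by (intro sum.cong) auto
  finally show ?thesis by simp
qed

lemma L2_set_norm_sq: "L2_set v {..<d} = sqrt (norm_sq d v)"
  by (simp add: L2_set_def norm_sq_def)

text \<open>Let \<sigma> be the sign that makes coordinate 0 of \<sigma> y nonnegative. Against
  \<sigma> y every wrong guess costs at least \<epsilon>; against its negative, coordinate 0 alone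
  costs at least a, as much as a wrong guess everywhere. Finally sqrt m \<ge> m / sqrt (d - 1) for m
  \<le> d - 1 makes the bound linear in the number of wrong guesses, as needed for a sum over
  coordinates.\<close>

lemma sign_loss_ge:
  fixes y :: "nat \<Rightarrow> real" and V :: "nat set"
  assumes d: "2 \<le> d" and \<epsilon>: "0 < \<epsilon>" and a: "0 \<le> a" "real (d - 1) * \<epsilon>\<^sup>2 \<le> a\<^sup>2"
  defines "W \<equiv> {j\<in>{1..<d}. guess y j \<noteq> (j \<in> V)}"
  shows "\<epsilon> / sqrt (real (d - 1)) * real (card W) \<le> sign_loss d (cube_point d a \<epsilon> V) y"
proof -
  define \<sigma> :: real where "\<sigma> = (if 0 \<le> y 0 then 1 else -1)"
  let ?\<theta> = "cube_point d a \<epsilon> V"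
  have W: "finite W" "W \<subseteq> {1..<d}" by (auto simp: W_def)
  have "card W \<le> card {1..<d}" by (intro card_mono W) simp
  then have cW: "real (card W) \<le> real (d - 1)" by simp
  have 1: "real (card W) * \<epsilon>\<^sup>2 \<le> norm_sq d (\<lambda>j. ?\<theta> j - \<sigma> * y j)"
  proof -
    have "\<epsilon>\<^sup>2 \<le> (?\<theta> j - \<sigma> * y j)\<^sup>2" if "j \<in> W" for j
    proof -
      have "\<epsilon> \<le> \<bar>?\<theta> j - \<sigma> * y j\<bar>"
        using that \<epsilon> by (auto simp: W_def guess_def \<sigma>_def cube_point_def split: if_splits)
      then show ?thesis using \<epsilon> by (simp add: abs_le_square_iff[symmetric])
    qed
    then have "(\<Sum>j\<in>W. \<epsilon>\<^sup>2) \<le> (\<Sum>j\<in>W. (?\<theta> j - \<sigma> * y j)\<^sup>2)" by (intro sum_mono)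
    also have "\<dots> \<le> norm_sq d (\<lambda>j. ?\<theta> j - \<sigma> * y j)"
      unfolding norm_sq_def using W by (intro sum_mono2) auto
    finally show ?thesis by simp
  qed
  have 2: "real (card W) * \<epsilon>\<^sup>2 \<le> norm_sq d (\<lambda>j. ?\<theta> j + \<sigma> * y j)"
  proof -
    have "real (card W) * \<epsilon>\<^sup>2 \<le> real (d - 1) * \<epsilon>\<^sup>2" using cW by (intro mult_right_mono) auto
    also have "\<dots> \<le> a\<^sup>2" by (rule a)
    also have "\<dots> \<le> (?\<theta> 0 + \<sigma> * y 0)\<^sup>2"
      using a d by (intro power_mono) (auto simp: cube_point_def \<sigma>_def)
    also have "\<dots> \<le> (\<Sum>j\<in>{..<d}. (?\<theta> j + \<sigma> * y j)\<^sup>2)"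
      using d by (intro member_le_sum) auto
    finally show ?thesis by (simp add: norm_sq_def)
  qed
  have "\<epsilon> / sqrt (real (d - 1)) * real (card W) \<le> sqrt (real (card W) * \<epsilon>\<^sup>2)"
  proof (rule real_le_rsqrt)
    have "real (card W) * real (card W) * \<epsilon>\<^sup>2 \<le> real (d - 1) * real (card W) * \<epsilon>\<^sup>2"
      using cW by (intro mult_right_mono) auto
    then show "(\<epsilon> / sqrt (real (d - 1)) * real (card W))\<^sup>2 \<le> real (card W) * \<epsilon>\<^sup>2"
      using d by (simp add: power_mult_distrib power_divide field_simps) (simp add: power2_eq_square mult_ac)
  qed
  also have "\<dots> \<le> min (L2_set (\<lambda>j. ?\<theta> j - \<sigma> * y j) {..<d}) (L2_set (\<lambda>j. ?\<theta> j + \<sigma> * y j) {..<d})"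
    unfolding L2_set_norm_sq using 1 2 by simp
  also have "\<dots> = sign_loss d ?\<theta> y"
    by (simp add: sign_loss_def \<sigma>_def min.commute)
  finally show ?thesis .
qed

text \<open>Assouad's lemma: the supremum dominates the average risk over the vertices, each risk
  dominates a sum of error probabilities over coordinates, and along each edge
  \<open>test_error\<close> bounds the two errors together from below.\<close>

lemma minimax_rate_ge:
  assumes \<delta>: "0 < \<delta>" "\<delta> \<le> 1/2" and d: "2 \<le> d" and \<epsilon>: "0 < \<epsilon>"
    and t: "0 < t" "2 * real (d - 1) * \<epsilon>\<^sup>2 \<le> t\<^sup>2"
    and small: "t\<^sup>2 * \<epsilon>\<^sup>2 * real n / \<delta> \<le> 1/4 \<or> 2 * real n * \<epsilon>\<^sup>2 \<le> 1/4"
  shows "ennreal (\<epsilon> * sqrt (real (d - 1)) / 8) \<le> minimax_rate n d \<delta> t"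
  unfolding minimax_rate_def
proof (rule INF_greatest)
  fix est assume est: "est \<in> measurable (sample_space n d) (vec_space d)"
  \<comment> \<open>This puts every vertex on the sphere of radius t. The factor 2 in the hypothesis
    on t gives the lower bound on \<open>a\<^sup>2\<close> required by
    \<open>sign_loss_ge\<close>.\<close>
  define a where "a = sqrt (t\<^sup>2 - real (d - 1) * \<epsilon>\<^sup>2)"
  define \<theta> where "\<theta> = cube_point d a \<epsilon>"
  define c where "c = \<epsilon> / sqrt (real (d - 1))"
  define J where "J = {1..<d}"
  define \<Omega> where "\<Omega> = space (sample_space n d)"
  define D where "D j = {x\<in>\<Omega>. guess (est x) j}" for j
  define Err where "Err V j = (if j \<in> V then \<Omega> - D j else D j)" for V j
  define P where "P V = sample_law n d \<delta> (\<theta> V)" for V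
  define R where "R V = (\<integral>\<^sup>+x. ennreal (sign_loss d (\<theta> V) (est x)) \<partial>P V)" for V
  define K where "K = (SUP \<theta>\<in>{\<theta>\<in>space (vec_space d). L2_set \<theta> {..<d} = t}. \<integral>\<^sup>+x. ennreal (sign_loss d \<theta> (est x)) \<partial>sample_law n d \<delta> \<theta>)"
  have "0 \<le> real (d - 1) * \<epsilon>\<^sup>2" by simp
  then have le: "real (d - 1) * \<epsilon>\<^sup>2 \<le> t\<^sup>2" using t(2) unfolding mult.assoc by linarith
  have a2: "a\<^sup>2 = t\<^sup>2 - real (d - 1) * \<epsilon>\<^sup>2"
    using le unfolding a_def by (subst real_sqrt_pow2) auto
  have a: "0 \<le> a" "real (d - 1) * \<epsilon>\<^sup>2 \<le> a\<^sup>2"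
    using t(2) le unfolding a2 mult.assoc by (simp_all add: a_def)
  have J: "finite J" "card J = d - 1" by (simp_all add: J_def)
  have sets_P: "sets (P V) = sets (sample_space n d)" for V
    by (simp add: P_def sample_law_def)
  have est_j: "(\<lambda>x. est x j) \<in> borel_measurable (sample_space n d)" if "j < d" for j
    using measurable_compose[OF est, of "\<lambda>y. y j" borel] that
    by (simp add: vec_space_def measurable_component_singleton)
  have D: "D j \<in> sets (sample_space n d)" if "j \<in> J" for j
  proof -
    have [measurable]: "(\<lambda>x. est x 0) \<in> borel_measurable (sample_space n d)" "(\<lambda>x. est x j) \<in> borel_measurable (sample_space n d)"
      using est_j d that by (auto simp: J_def)
    show ?thesis unfolding D_def guess_def \<Omega>_def by measurable
  qed
  have Err: "Err V j \<in> sets (P V)" if "j \<in> J" for V j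
    using D[OF that] by (auto simp: Err_def sets_P \<Omega>_def)
  have c: "0 \<le> c" using \<epsilon> by (simp add: c_def)
  have R_le: "R V \<le> K" for V
  proof -
    have "L2_set (\<theta> V) {..<d} = t"
      using t d unfolding \<theta>_def L2_set_norm_sq by (subst norm_sq_cube_point) (simp_all add: a2)
    moreover have "\<theta> V \<in> space (vec_space d)"
      by (simp add: \<theta>_def vec_space_def space_PiM cube_point_def)
    ultimately show ?thesis unfolding R_def K_def P_def by (intro SUP_upper) auto
  qed
  have R_ge: "ennreal c * (\<Sum>j\<in>J. emeasure (P V) (Err V j)) \<le> R V" for V
  proof -
    have "ennreal c * (\<Sum>j\<in>J. emeasure (P V) (Err V j)) = (\<integral>\<^sup>+x. ennreal c * (\<Sum>j\<in>J. indicator (Err V j) x) \<partial>P V)"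
      using Err by (simp add: nn_integral_cmult nn_integral_sum)
    also have "\<dots> \<le> R V"
      unfolding R_def
    proof (rule nn_integral_mono)
      fix x assume "x \<in> space (P V)"
      then have x: "x \<in> \<Omega>" using sets_eq_imp_space_eq[OF sets_P[of V]] by (simp add: \<Omega>_def)
      have "(\<Sum>j\<in>J. indicator (Err V j) x) = (\<Sum>j\<in>J. of_bool (guess (est x) j \<noteq> (j \<in> V)) :: ennreal)"
        using x by (intro sum.cong refl) (auto simp: Err_def D_def indicator_def)
      also have "\<dots> = of_nat (card {j\<in>J. guess (est x) j \<noteq> (j \<in> V)})"
        using J by (simp add: sum_of_bool_eq Int_def)
      finally have "ennreal c * (\<Sum>j\<in>J. indicator (Err V j) x)
          = ennreal (c * real (card {j\<in>J. guess (est x) j \<noteq> (j \<in> V)}))"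
        using c by (simp add: ennreal_mult ennreal_of_nat_eq_real_of_nat)
      also have "\<dots> \<le> ennreal (sign_loss d (\<theta> V) (est x))"
        unfolding \<theta>_def c_def J_def using sign_loss_ge[OF d \<epsilon> a] by (intro ennreal_leI)
      finally show "ennreal c * (\<Sum>j\<in>J. indicator (Err V j) x) \<le> ennreal (sign_loss d (\<theta> V) (est x))" .
    qed
    finally show ?thesis .
  qed
  have pair: "ennreal (1/4) \<le> emeasure (P V) (Err V j) + emeasure (P (insert j V)) (Err (insert j V) j)"
    if j: "j \<in> J" and V: "V \<in> Pow (J - {j})" for j V
  proof -
    \<comment> \<open>u is the midpoint of the edge and w half of the edge; they have disjoint
      supports, hence are orthogonal.\<close>
    define u where "u = (\<theta> V)(j := 0)"
    define w where "w = (\<lambda>_. 0)(j := \<epsilon>)"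
    have jd: "j < d" "j \<noteq> 0" "j \<notin> V" using j V by (auto simp: J_def)
    have norm_w: "norm_sq d w = \<epsilon>\<^sup>2"
      unfolding norm_sq_def using jd by (subst sum.remove[of _ j]) (auto simp: w_def)
    have "norm_sq d u \<le> norm_sq d (\<theta> V)"
      unfolding norm_sq_def u_def by (intro sum_mono) auto
    also have "\<dots> = t\<^sup>2"
      unfolding \<theta>_def using d by (subst norm_sq_cube_point) (simp_all add: a2)
    finally have "norm_sq d u \<le> t\<^sup>2" .
    then have "norm_sq d u * \<epsilon>\<^sup>2 * real n / \<delta> \<le> t\<^sup>2 * \<epsilon>\<^sup>2 * real n / \<delta>"
      using \<delta> by (intro divide_right_mono mult_right_mono) auto
    then have small': "norm_sq d u * norm_sq d w * real n / \<delta> \<le> 1/4 \<or> 2 * real n * norm_sq d w \<le> 1/4"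
      using small unfolding norm_w by linarith
    have orth: "(\<Sum>j\<in>{..<d}. u j * w j) = 0"
      by (intro sum.neutral) (auto simp: u_def w_def)
    have plus: "\<forall>i<d. \<theta> (insert j V) i = u i + w i"
      using jd by (auto simp: \<theta>_def u_def w_def cube_point_def)
    have minus: "\<forall>i<d. \<theta> V i = u i - w i"
      using jd by (auto simp: \<theta>_def u_def w_def cube_point_def)
    have "\<Omega> - D j \<in> sets (sample_space n d)" using D[OF j] by (auto simp: \<Omega>_def)
    from test_error[OF \<delta> orth plus minus small' this]
    have "ennreal (1/4) \<le> emeasure (P (insert j V)) (\<Omega> - D j) + emeasure (P V) (\<Omega> - (\<Omega> - D j))"
      by (simp add: P_def \<Omega>_def)
    moreover have "\<Omega> - (\<Omega> - D j) = D j" by (auto simp: D_def)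
    ultimately show ?thesis
      using jd by (simp add: Err_def add.commute)
  qed
  \<comment> \<open>Each of the d - 1 directions has \<open>2 ^ (d - 2)\<close> edges, half the
    number of vertices; this half and the 1/4 per edge make the constant 1/8.\<close>
  have "ennreal (2 ^ (d - 1) * (\<epsilon> * sqrt (real (d - 1)) / 8)) = ennreal c * (\<Sum>j\<in>J. \<Sum>V\<in>Pow (J - {j}). ennreal (1/4))"
  proof -
    have "(\<Sum>V\<in>Pow (J - {j}). ennreal (1/4)) = ennreal (2 ^ (d - 2) / 4)" if "j \<in> J" for j
      using J that d by (simp add: card_Pow ennreal_of_nat_eq_real_of_nat ennreal_mult[symmetric] numeral_2_eq_2)
    then have "(\<Sum>j\<in>J. \<Sum>V\<in>Pow (J - {j}). ennreal (1/4)) = (\<Sum>j\<in>J. ennreal (2 ^ (d - 2) / 4))"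
      by (intro sum.cong refl)
    also have "\<dots> = ennreal (real (d - 1) * (2 ^ (d - 2) / 4))"
      using J by (simp add: ennreal_of_nat_eq_real_of_nat ennreal_mult[symmetric])
    finally have "ennreal c * (\<Sum>j\<in>J. \<Sum>V\<in>Pow (J - {j}). ennreal (1/4)) = ennreal (c * (real (d - 1) * (2 ^ (d - 2) / 4)))"
      using c by (simp only: ennreal_mult')
    moreover have "2 ^ (d - 1) = 2 * (2 ^ (d - 2) :: real)"
      using d by (simp flip: power_Suc add: Suc_diff_le)
    moreover have "real (d - 1) = sqrt (real (d - 1)) * sqrt (real (d - 1))" by simp
    then have "c * real (d - 1) = \<epsilon> * sqrt (real (d - 1))"
      using d unfolding c_def by (simp add: field_simps)
    ultimately show ?thesis by (simp add: mult.assoc[symmetric])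
  qed
  also have "\<dots> \<le> ennreal c * (\<Sum>j\<in>J. \<Sum>V\<in>Pow (J - {j}). emeasure (P V) (Err V j) + emeasure (P (insert j V)) (Err (insert j V) j))"
    by (intro mult_left_mono sum_mono pair) auto
  also have "\<dots> = ennreal c * (\<Sum>j\<in>J. \<Sum>V\<in>Pow J. emeasure (P V) (Err V j))"
    by (intro arg_cong[where f = "\<lambda>z. ennreal c * z"] sum.cong refl
        sum_Pow_split[where f = "\<lambda>V. emeasure (P V) (Err V _)", symmetric] J(1))
  also have "\<dots> = (\<Sum>V\<in>Pow J. ennreal c * (\<Sum>j\<in>J. emeasure (P V) (Err V j)))"
    by (subst sum.swap) (simp add: sum_distrib_left)
  also have "\<dots> \<le> (\<Sum>V\<in>Pow J. K)"
    by (intro sum_mono order_trans[OF R_ge R_le])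
  also have "\<dots> = ennreal (2 ^ (d - 1)) * K"
    using J by (simp add: card_Pow ennreal_of_nat_eq_real_of_nat)
  finally have "ennreal (2 ^ (d - 1)) * ennreal (\<epsilon> * sqrt (real (d - 1)) / 8) \<le> ennreal (2 ^ (d - 1)) * K"
    by (simp only: ennreal_mult' zero_le_power zero_le_numeral)
  then have "ennreal (\<epsilon> * sqrt (real (d - 1)) / 8) \<le> K"
    by (subst (asm) ennreal_mult_le_mult_iff) auto
  then show "ennreal (\<epsilon> * sqrt (real (d - 1)) / 8) \<le> (SUP \<theta>\<in>{\<theta>\<in>space (vec_space d). L2_set \<theta> {..<d} = t}. \<integral>\<^sup>+x. ennreal (sign_loss d \<theta> (est x)) \<partial>sample_law n d \<delta> \<theta>)"
    unfolding K_def .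
qed

section \<open>The choice of the cube in the three regimes of the rate\<close>

lemma one_le_sqrt_ln:
  assumes "(4::real) \<le> x"
  shows "1 \<le> sqrt (ln x)"
proof -
  have "exp 1 \<le> (3::real)" using exp_le by simp
  then have "exp 1 \<le> x" using assms by linarith
  then have "1 \<le> ln x" using assms by (subst ln_ge_iff) auto
  then show ?thesis by simp
qed

theorem theorem2:
  "\<exists>c::real. c > 0 \<and>
     (\<forall>(n::nat) (d::nat) (\<delta>::real) (t::real).
        0 \<le> \<delta> \<longrightarrow> \<delta> \<le> 1/2 \<longrightarrow> 2 \<le> d \<longrightarrow> real d \<le> \<delta> * real n \<longrightarrow> real n \<ge> 128 / real d \<longrightarrow> t > 0 \<longrightarrow>
        minimax_rate n d \<delta> t \<ge> ennreal (c / sqrt (ln (real n)) * lower_rate n d \<delta> t))"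
proof (rule exI[of _ "1/32"], intro conjI allI impI)
  fix n d :: nat and \<delta> t :: real
  assume \<delta>0: "0 \<le> \<delta>" and \<delta>: "\<delta> \<le> 1/2" and d: "2 \<le> d" and dn: "real d \<le> \<delta> * real n" and t: "0 < t"
  have pos: "0 < \<delta> * real n" using d dn by linarith
  then have \<delta>pos: "0 < \<delta>" and npos: "0 < real n"
    using \<delta>0 by (auto simp: zero_less_mult_iff)
  \<comment> \<open>This leads to n \<ge> 4, so \<open>sqrt (ln n)\<close> is at least 1 and
    dividing by it only weakens the bound.\<close>
  have "2 \<le> \<delta> * real n" using d dn by linarith
  also have "\<dots> \<le> 1/2 * real n" using \<delta> npos by (intro mult_right_mono) auto
  finally have n: "4 \<le> real n" by simp
  define q where "q = \<delta> * real d / real n"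
  have q: "0 < q" using \<delta>pos d npos by (simp add: q_def)
  have d1: "0 < real (d - 1)" "real d \<le> 2 * real (d - 1)" using d by auto
  \<comment> \<open>Here e stands for \<epsilon> squared and r for the rate of the regime. Since r
    is at most 4 sqrt (e (d - 1)), the factor 1/8 of \<open>minimax_rate_ge\<close> becomes
    1/32.\<close>
  have key: "ennreal (1/32 / sqrt (ln (real n)) * r) \<le> minimax_rate n d \<delta> t"
    if r: "0 \<le> r" and e: "0 < e" and re: "r\<^sup>2 \<le> 16 * real (d - 1) * e"
      and et: "2 * real (d - 1) * e \<le> t\<^sup>2"
      and small: "t\<^sup>2 * e * real n / \<delta> \<le> 1/4 \<or> 2 * real n * e \<le> 1/4" for r e
  proof -
    have "r \<le> sqrt (16 * real (d - 1) * e)" by (rule real_le_rsqrt) (rule re)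
    also have "\<dots> = 4 * (sqrt e * sqrt (real (d - 1)))" by (simp add: real_sqrt_mult)
    finally have "1/32 * r \<le> sqrt e * sqrt (real (d - 1)) / 8" by simp
    moreover have "1/32 / sqrt (ln (real n)) * r \<le> 1/32 * r"
      using one_le_sqrt_ln[OF n] r by (intro mult_right_mono) (auto simp: field_simps)
    ultimately have "1/32 / sqrt (ln (real n)) * r \<le> sqrt e * sqrt (real (d - 1)) / 8" by linarith
    then have "ennreal (1/32 / sqrt (ln (real n)) * r) \<le> ennreal (sqrt e * sqrt (real (d - 1)) / 8)"
      by (rule ennreal_leI)
    also have "\<dots> \<le> minimax_rate n d \<delta> t"
      using e et small by (intro minimax_rate_ge[OF \<delta>pos \<delta> d _ t]) auto
    finally show ?thesis .
  qed
  have root: "(q powr (1/4)) ^ 4 = q"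
    using q by (simp add: powr_power)
  have qn: "q * real n = \<delta> * real d" using npos by (simp add: q_def)
  show "ennreal (1/32 / sqrt (ln (real n)) * lower_rate n d \<delta> t) \<le> minimax_rate n d \<delta> t"
  proof (cases "t \<le> q powr (1/4)")
    case True
    \<comment> \<open>The cube coordinates take one eighth of the squared norm, so the loss is of
      order t; t ^ 4 \<le> q makes neighbouring vertices hard to distinguish.\<close>
    define e where "e = t\<^sup>2 / (8 * real (d - 1))"
    have "m * (t\<^sup>2 / (8 * m)) = t\<^sup>2 / 8" if "0 < m" for m :: real using that by simp
    from this[OF d1(1)] have de: "real (d - 1) * e = t\<^sup>2 / 8" unfolding e_def .
    have "t ^ 4 \<le> (q powr (1/4)) ^ 4" using True t by (intro power_mono) auto
    then have t4: "t ^ 4 * real n \<le> \<delta> * real d" using root qn npos by (metis mult_right_mono less_imp_le)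
    have "t\<^sup>2 * e * real n / \<delta> = t ^ 4 * real n / (8 * real (d - 1) * \<delta>)"
      by (simp add: e_def field_simps flip: power_add)
    also have "\<dots> \<le> \<delta> * real d / (8 * real (d - 1) * \<delta>)"
      using t4 \<delta>pos by (intro divide_right_mono) auto
    also have "\<dots> \<le> 1/4" using d1 \<delta>pos by (simp add: field_simps)
    finally have "t\<^sup>2 * e * real n / \<delta> \<le> 1/4" .
    moreover have "lower_rate n d \<delta> t = t" using True by (simp add: lower_rate_def q_def)
    moreover have "0 < e" using t d1 by (simp add: e_def)
    moreover have "t\<^sup>2 \<le> 16 * real (d - 1) * e" "2 * real (d - 1) * e \<le> t\<^sup>2"
      using de zero_le_power2[of t] unfolding mult.assoc by linarith+
    ultimately show ?thesis using key[of t e] t by simp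
  next
    case False
    have tq: "q \<le> t ^ 4"
      using False root power_mono[of "q powr (1/4)" t 4] by simp
    show ?thesis
    proof (cases "t \<le> sqrt \<delta>")
      case True
      \<comment> \<open>The largest value allowed by the first alternative in \<open>small\<close>;
        q \<le> t ^ 4 ensures that the cube fits on the sphere.\<close>
      define e where "e = \<delta> / (4 * real n * t\<^sup>2)"
      have e: "0 < e" using \<delta>pos npos t by (simp add: e_def)
      have rate: "lower_rate n d \<delta> t = 1 / t * sqrt q"
        using True False by (simp add: lower_rate_def q_def)
      have "(1 / t * sqrt q)\<^sup>2 = q / t\<^sup>2" using q by (simp add: power_mult_distrib power_divide)
      also have "\<dots> = 4 * real d * e" using npos t by (simp add: q_def e_def field_simps)
      also have "\<dots> \<le> 4 * (2 * real (d - 1)) * e" using d1 e by (intro mult_right_mono mult_left_mono) auto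
      also have "\<dots> \<le> 16 * real (d - 1) * e" using d1 e by simp
      finally have 1: "(1 / t * sqrt q)\<^sup>2 \<le> 16 * real (d - 1) * e" .
      have "2 * real (d - 1) * e \<le> 2 * real d * e" using e by (intro mult_right_mono) auto
      also have "\<dots> = q / t\<^sup>2 / 2" using npos t by (simp add: q_def e_def field_simps)
      also have "\<dots> \<le> t ^ 4 / t\<^sup>2 / 2" using tq by (intro divide_right_mono) auto
      also have "\<dots> \<le> t\<^sup>2" using t by (simp add: power2_eq_square power4_eq_xxxx)
      finally have 2: "2 * real (d - 1) * e \<le> t\<^sup>2" .
      have "t\<^sup>2 * e * real n / \<delta> \<le> 1/4" using npos t \<delta>pos by (simp add: e_def)
      with 1 2 e t q show ?thesis unfolding rate by (intro key) auto
    next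
      case t\<delta>: False
      \<comment> \<open>The largest value allowed by the second alternative in \<open>small\<close>;
        here d \<le> \<delta> n together with \<delta> \<le> \<open>t\<^sup>2\<close> makes the cube
        fit on the sphere.\<close>
      define e where "e = 1 / (8 * real n)"
      have e: "0 < e" using npos by (simp add: e_def)
      have rate: "lower_rate n d \<delta> t = sqrt (real d / real n)"
        using t\<delta> False by (simp add: lower_rate_def q_def)
      have "(sqrt (real d / real n))\<^sup>2 = 8 * real d * e" using npos by (simp add: e_def)
      also have "\<dots> \<le> 8 * (2 * real (d - 1)) * e" using d1 e by (intro mult_right_mono mult_left_mono) auto
      finally have 1: "(sqrt (real d / real n))\<^sup>2 \<le> 16 * real (d - 1) * e" by simp
      have "\<delta> \<le> t\<^sup>2" using t\<delta> \<delta>pos t by (meson less_imp_le not_le real_le_rsqrt real_sqrt_le_iff real_sqrt_less_iff sqrt_le_D)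
      have "2 * real (d - 1) * e \<le> 2 * real d * e" using e by (intro mult_right_mono) auto
      also have "\<dots> \<le> 2 * (\<delta> * real n) * e" using e dn by (intro mult_right_mono) auto
      also have "\<dots> = \<delta> / 4" using npos by (simp add: e_def)
      also have "\<dots> \<le> t\<^sup>2" using \<open>\<delta> \<le> t\<^sup>2\<close> \<delta>pos by simp
      finally have 2: "2 * real (d - 1) * e \<le> t\<^sup>2" .
      have "2 * real n * e \<le> 1/4" using npos by (simp add: e_def)
      with 1 2 e show ?thesis unfolding rate by (intro key) auto
    qed
  qed
qed simp

end
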